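(* For every integer $d \ge 2$ and every integer $r \ge 2$ there exist $\beta_0 > 0$ and $\gamma_0 > 0$ such that for every $\beta \le \beta_0$ and $\gamma \ge \gamma_0$ (with $0<\beta<\gamma$) the following holds. Let $g \in \hat{\mathcal{E}}^{r+1}_d$ be an expanding circle map such that $$\|g - L_d\|_{C^2} < \frac{d-1}{2} \quad\text{and}\quad \mathscr{L}(g) \text{ is } (\beta,\gamma)\text{-sparse}.$$ Then there exists $\varepsilon = \varepsilon(g) > 0$ such that every $f \in \mathcal{E}^r_d$ with $$\|f - g\|_{C^{r,1}} < \varepsilon \quad\text{and}\quad \mathscr{L}(f) = \mathscr{L}(g)$$ is $C^r$-smoothly conjugate to $g$. In particular, the marking conjugacy $\varphi$ between $f$ and $g$ is a $C^r$-smooth diffeomorphism.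
   Context: $\mathbb{S}^1 = \mathbb{R}/\mathbb{Z}$ and $L_d\colon x \mapsto d\cdot x \bmod 1$. A map is $C^{r,1}$-smooth if it has $r$ derivatives and the $r$-th derivative is Lipschitz. $\mathcal{E}^r_d$ is the class of $C^{r,1}$-smooth circle endomorphisms $f \colon \mathbb{S}^1 \to \mathbb{S}^1$ of degree $d$ with $f(0)=0$ and $f'(x) > 1$ for all $x \in \mathbb{S}^1$. $\hat{\mathcal{E}}^r_d \subset \mathcal{E}^r_d$ is the subclass of maps preserving the Lebesgue measure on $\mathbb{S}^1$. For real-valued functions $u$ on $\mathbb{S}^1$, $\|u\|_{C^{k}} = \max_{0\le j \le k} \sup_x |u^{(j)}(x)|$ and $\|u\|_{C^{k,1}}$ is the maximum of $\|u\|_{C^k}$ and the optimal Lipschitz constant of $u^{(k)}$. The difference of two degree $d$ maps fixing $0$ is regarded as a real-valued function on $\mathbb{S}^1$ via the lifts to $\mathbb{R}$ that fix $0$. For $f \in \mathcal{E}^r_d$, $\mathbb{P}^f_n$ is the set of all periodic points of $f$ of (possibly not exact) period $n$; the log-multiplier of $p\in\mathbb{P}^f_n$ is $\lambda^f(p) = \log (f^n)'(p)$; $\mathscr{L}_n(f) = \{\lambda^f(p) : p \in \mathbb{P}^f_n\}$; and the (unmarked) length spectrum is the set $\mathscr{L}(f) = \bigcup_{n \in \mathbb{N}} \mathscr{L}_n(f)$. For $0<\beta<\gamma$, the length spectrum $\mathscr{L}(f)$ is called $(\beta,\gamma)$-sparse if there exist coefficients $C_\beta > 0$, $C_\gamma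 > 0$ such that for all $\ell_1, \ell_2 \in \mathscr{L}(f)$, either $|\ell_1 - \ell_2| \ge C_\beta e^{-\beta \max\{\ell_1,\ell_2\}}$ or $|\ell_1 - \ell_2| \le C_\gamma e^{-\gamma \min\{\ell_1,\ell_2\}}$. Any two maps $f, g$ of these classes (same $d$) are topologically conjugate by an orientation-preserving homeomorphism $\varphi\colon \mathbb{S}^1 \to \mathbb{S}^1$ respecting the symbolic dynamics (with $\varphi(0)=0$): $g = \varphi \circ f \circ \varphi^{-1}$; this $\varphi$ is called the marking conjugacy. *)

theory Defs
  imports "HOL-Analysis.Analysis"
begin

section \<open>The circle\<close>

quotient_type circle = real / "\<lambda>x y. x - y \<in> \<int>"
proof (rule equivpI)
  show "reflp (\<lambda>x y :: real. x - y \<in> \<int>)"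
    by (simp add: reflp_def)
  show "symp (\<lambda>x y :: real. x - y \<in> \<int>)"
    by (metis Ints_minus minus_diff_eq sympI)
  show "transp (\<lambda>x y :: real. x - y \<in> \<int>)"
  proof (rule transpI)
    fix x y z :: real
    assume "x - y \<in> \<int>" "y - z \<in> \<int>"
    then have "(x - y) + (y - z) \<in> \<int>" by (rule Ints_add)
    then show "x - z \<in> \<int>" by simp
  qed
qed

abbreviation to_circle :: "real \<Rightarrow> circle" where
  "to_circle \<equiv> abs_circle"

instantiation circle :: zero
begin
definition zero_circle :: circle where "0 = to_circle 0"
instance ..
end

instantiation circle :: topological_space
begin
definition open_circle :: "circle set \<Rightarrow> bool" where
  "open U \<longleftrightarrow> open (to_circle -` U)"
instance
proof
  show "open (UNIV :: circle set)"
    by (simp add: open_circle_def)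
  show "open (S \<inter> T)" if "open S" "open T" for S T :: "circle set"
    using that by (auto simp: open_circle_def vimage_Int)
  show "open (\<Union>K)" if "\<forall>S\<in>K. open S" for K :: "circle set set"
    using that by (auto simp: open_circle_def vimage_Union)
qed
end

definition circle_lebesgue :: "circle measure" where
  "circle_lebesgue = distr (restrict_space lborel {0..<1}) borel to_circle"

definition preserves_lebesgue :: "(circle \<Rightarrow> circle) \<Rightarrow> bool" where
  "preserves_lebesgue f \<longleftrightarrow>
     f \<in> measurable circle_lebesgue circle_lebesgue \<and>
     distr circle_lebesgue circle_lebesgue f = circle_lebesgue"

lift_definition linear_map :: "nat \<Rightarrow> circle \<Rightarrow> circle" is "\<lambda>d x. real d * x"
  by (metis Ints_mult Ints_of_nat right_diff_distrib)


section \<open>Lifts\<close>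

definition is_lift :: "(real \<Rightarrow> real) \<Rightarrow> (circle \<Rightarrow> circle) \<Rightarrow> bool" where
  "is_lift F f \<longleftrightarrow> continuous_on UNIV F \<and> (\<forall>x. to_circle (F x) = f (to_circle x))"

definition has_degree :: "(circle \<Rightarrow> circle) \<Rightarrow> nat \<Rightarrow> bool" where
  "has_degree f d \<longleftrightarrow> (\<exists>F. is_lift F f \<and> (\<forall>x. F (x + 1) = F x + real d))"

text \<open>Well defined for continuous \<open>f\<close> with \<open>f 0 = 0\<close>.\<close>

definition lift0 :: "(circle \<Rightarrow> circle) \<Rightarrow> real \<Rightarrow> real" where
  "lift0 f = (THE F. is_lift F f \<and> F 0 = 0)"

text \<open>For \<open>f\<close> fixing \<open>0\<close>; the value does not depend on the representative of \<open>p\<close>,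
  because the derivative of a lift is 1-periodic.\<close>

definition circle_deriv :: "(circle \<Rightarrow> circle) \<Rightarrow> circle \<Rightarrow> real" where
  "circle_deriv f p = deriv (lift0 f) (rep_circle p)"


section \<open>Smoothness and norms\<close>

definition times_differentiable :: "nat \<Rightarrow> (real \<Rightarrow> real) \<Rightarrow> bool" where
  "times_differentiable k u \<longleftrightarrow> (\<forall>j<k. \<forall>x. (deriv ^^ j) u differentiable (at x))"

definition C_k :: "nat \<Rightarrow> (real \<Rightarrow> real) \<Rightarrow> bool" where
  "C_k k u \<longleftrightarrow> times_differentiable k u \<and> continuous_on UNIV ((deriv ^^ k) u)"

definition C_k1 :: "nat \<Rightarrow> (real \<Rightarrow> real) \<Rightarrow> bool" where
  "C_k1 k u \<longleftrightarrow> times_differentiable k u \<and> (\<exists>K. K-lipschitz_on UNIV ((deriv ^^ k) u))"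

definition circle_C_k :: "nat \<Rightarrow> (circle \<Rightarrow> circle) \<Rightarrow> bool" where
  "circle_C_k k f \<longleftrightarrow> (\<exists>F. is_lift F f \<and> C_k k F)"

definition circle_C_k1 :: "nat \<Rightarrow> (circle \<Rightarrow> circle) \<Rightarrow> bool" where
  "circle_C_k1 k f \<longleftrightarrow> (\<exists>F. is_lift F f \<and> C_k1 k F)"

text \<open>A real-valued function on the circle is represented by the corresponding 1-periodic
  function on the line; this changes neither suprema nor optimal Lipschitz constants.
  The suprema and the infimum below are the intended ones for 1-periodic \<open>u\<close>
  with \<open>C_k k u\<close>, resp. \<open>C_k1 k u\<close>.\<close>

definition C_k_norm :: "nat \<Rightarrow> (real \<Rightarrow> real) \<Rightarrow> real" where
  "C_k_norm k u = Max ((\<lambda>j. SUP x. \<bar>(deriv ^^ j) u x\<bar>) ` {0..k})"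

definition C_k1_norm :: "nat \<Rightarrow> (real \<Rightarrow> real) \<Rightarrow> real" where
  "C_k1_norm k u = max (C_k_norm k u) (Inf {K. K-lipschitz_on UNIV ((deriv ^^ k) u)})"

definition circle_diff :: "(circle \<Rightarrow> circle) \<Rightarrow> (circle \<Rightarrow> circle) \<Rightarrow> real \<Rightarrow> real" where
  "circle_diff f g = (\<lambda>x. lift0 f x - lift0 g x)"


section \<open>Expanding maps and their length spectra\<close>

definition expanding_maps :: "nat \<Rightarrow> nat \<Rightarrow> (circle \<Rightarrow> circle) set" where
  "expanding_maps d r =
     {f. circle_C_k1 r f \<and> has_degree f d \<and> f 0 = 0 \<and> (\<forall>x. circle_deriv f x > 1)}"

definition lebesgue_expanding_maps :: "nat \<Rightarrow> nat \<Rightarrow> (circle \<Rightarrow> circle) set" where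
  "lebesgue_expanding_maps d r = {f \<in> expanding_maps d r. preserves_lebesgue f}"

definition periodic_points :: "(circle \<Rightarrow> circle) \<Rightarrow> nat \<Rightarrow> circle set" where
  "periodic_points f n = {p. (f ^^ n) p = p}"

definition log_multiplier :: "(circle \<Rightarrow> circle) \<Rightarrow> nat \<Rightarrow> circle \<Rightarrow> real" where
  "log_multiplier f n p = ln (circle_deriv (f ^^ n) p)"

definition length_spectrum_at :: "(circle \<Rightarrow> circle) \<Rightarrow> nat \<Rightarrow> real set" where
  "length_spectrum_at f n = log_multiplier f n ` periodic_points f n"

definition length_spectrum :: "(circle \<Rightarrow> circle) \<Rightarrow> real set" where
  "length_spectrum f = (\<Union>n\<in>{1..}. length_spectrum_at f n)"

definition sparse_spectrum :: "real \<Rightarrow> real \<Rightarrow> real set \<Rightarrow> bool" where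
  "sparse_spectrum \<beta> \<gamma> S \<longleftrightarrow>
     (\<exists>C\<^sub>\<beta> > 0. \<exists>C\<^sub>\<gamma> > 0. \<forall>l\<^sub>1\<in>S. \<forall>l\<^sub>2\<in>S.
        \<bar>l\<^sub>1 - l\<^sub>2\<bar> \<ge> C\<^sub>\<beta> * exp (- \<beta> * max l\<^sub>1 l\<^sub>2) \<or>
        \<bar>l\<^sub>1 - l\<^sub>2\<bar> \<le> C\<^sub>\<gamma> * exp (- \<gamma> * min l\<^sub>1 l\<^sub>2))"


section \<open>Conjugacies\<close>

definition orientation_preserving :: "(circle \<Rightarrow> circle) \<Rightarrow> bool" where
  "orientation_preserving \<phi> \<longleftrightarrow> (\<exists>\<Phi>. is_lift \<Phi> \<phi> \<and> strict_mono \<Phi>)"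

text \<open>An orientation-preserving conjugacy that fixes \<open>0\<close> maps the fundamental arcs of \<open>f\<close>,
  bounded by the points of \<open>f -` {0}\<close>, to those of \<open>g\<close> in their order from \<open>0\<close>,
  so it respects the symbolic dynamics.\<close>

definition marking_conjugacy ::
  "(circle \<Rightarrow> circle) \<Rightarrow> (circle \<Rightarrow> circle) \<Rightarrow> (circle \<Rightarrow> circle) \<Rightarrow> bool" where
  "marking_conjugacy f g \<phi> \<longleftrightarrow>
     homeomorphism UNIV UNIV \<phi> (inv \<phi>) \<and> orientation_preserving \<phi> \<and> \<phi> 0 = 0 \<and>
     g = \<phi> \<circ> f \<circ> inv \<phi>"

definition C_k_diffeomorphism :: "nat \<Rightarrow> (circle \<Rightarrow> circle) \<Rightarrow> bool" where
  "C_k_diffeomorphism k \<phi> \<longleftrightarrow> bij \<phi> \<and> circle_C_k k \<phi> \<and> circle_C_k k (inv \<phi>)"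

definition C_k_conjugate :: "nat \<Rightarrow> (circle \<Rightarrow> circle) \<Rightarrow> (circle \<Rightarrow> circle) \<Rightarrow> bool" where
  "C_k_conjugate k f g \<longleftrightarrow> (\<exists>\<phi>. C_k_diffeomorphism k \<phi> \<and> g = \<phi> \<circ> f \<circ> inv \<phi>)"

end

theory Submission
  imports Defs
begin

text \<open>Let \<open>F\<close> be the lift of an expanding map \<open>f\<close>, \<open>G\<close> its inverse, \<open>\<psi> = ln F'\<close>, \<open>\<Lambda> = \<psi> 0\<close>
  and \<open>\<omega> x = (\<Sum>i\<ge>1. \<psi> (G\<^sup>i x) - \<Lambda>)\<close>, so that \<open>\<psi> = \<Lambda> + \<omega> \<circ> F - \<omega>\<close> on the line. If \<open>y\<close> and \<open>z\<close> are
  close to \<open>0\<close> with \<open>F\<^sup>n y = z + 1\<close> and \<open>F\<^sup>m z = y + j\<close>, then \<open>y\<close> projects to a periodic point with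
  log-multiplier \<open>(n + m) \<Lambda> + (\<omega> (z + 1) - \<omega> z) + (\<omega> (y + j) - \<omega> y)\<close>. Comparing \<open>(n, 3n)\<close> with
  \<open>(2n, 2n)\<close> gives pairs of lengths near \<open>4n\<Lambda>\<close> whose difference is about
  \<open>(\<omega>' j - \<omega>' 0) exp (-n\<Lambda>)\<close>. Sparseness forbids this for all integers \<open>j\<close> unless \<open>\<omega>' j = \<omega>' 0\<close>,
  and the functional equation of \<open>\<omega>'\<close> then makes \<open>\<omega>\<close> 1-periodic. Hence \<open>ln F'\<close> is cohomologous to
  a constant on the circle: a sparse spectrum forces \<open>f\<close> to be smoothly conjugate to
  multiplication by \<open>d\<close>. This applies to \<open>f\<close> and to \<open>g\<close>, which share their spectrum, and the
  marking conjugacy is the composition of the two linearizations.\<close>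

section \<open>Continuously differentiable functions on the line\<close>

text \<open>Smoothness in recursive form, with the derivative as an existential witness: closure
  properties then go by induction on \<open>k\<close> for all functions at once, without computing
  iterates of \<open>deriv\<close>.\<close>

primrec cont_diff :: "nat \<Rightarrow> (real \<Rightarrow> real) \<Rightarrow> bool" where
  "cont_diff 0 u \<longleftrightarrow> continuous_on UNIV u"
| "cont_diff (Suc k) u \<longleftrightarrow> (\<exists>u'. (\<forall>x. (u has_real_derivative u' x) (at x)) \<and> cont_diff k u')"

lemma cont_diff_SucI:
  "(\<And>x. (u has_real_derivative u' x) (at x)) \<Longrightarrow> cont_diff k u' \<Longrightarrow> cont_diff (Suc k) u"
  by auto

lemma cont_diff_Suc_deriv:
  "cont_diff (Suc k) u \<longleftrightarrow> (\<forall>x. (u has_real_derivative deriv u x) (at x)) \<and> cont_diff k (deriv u)"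
proof
  assume "cont_diff (Suc k) u"
  then obtain u' where u': "\<And>x. (u has_real_derivative u' x) (at x)" "cont_diff k u'"
    by auto
  then have "deriv u = u'" by (auto intro!: DERIV_imp_deriv)
  with u' show "(\<forall>x. (u has_real_derivative deriv u x) (at x)) \<and> cont_diff k (deriv u)" by simp
qed (metis cont_diff_SucI)

lemma C_k_iff_cont_diff: "C_k k u \<longleftrightarrow> cont_diff k u"
proof (induction k arbitrary: u)
  case 0
  then show ?case by (simp add: C_k_def times_differentiable_def)
next
  case (Suc k)
  have funpow: "(deriv ^^ j) (deriv u) = (deriv ^^ Suc j) u" for j
    by (simp add: funpow_swap1)
  have "times_differentiable (Suc k) u \<longleftrightarrow>
      (\<forall>x. u differentiable (at x)) \<and> times_differentiable k (deriv u)"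
    unfolding times_differentiable_def funpow by (subst All_less_Suc2) simp
  moreover have "(\<forall>x. u differentiable (at x)) \<longleftrightarrow> (\<forall>x. (u has_real_derivative deriv u x) (at x))"
    by (metis DERIV_deriv_iff_real_differentiable)
  ultimately show ?case
    unfolding cont_diff_Suc_deriv Suc.IH[symmetric] C_k_def funpow by blast
qed

lemma C_k1_imp_cont_diff: "C_k1 k u \<Longrightarrow> cont_diff k u"
  unfolding C_k_iff_cont_diff[symmetric] C_k1_def C_k_def
  using lipschitz_on_continuous_on by blast

lemma cont_diff_continuous: "cont_diff k u \<Longrightarrow> continuous_on A u"
proof (cases k)
  case (Suc m)
  moreover assume "cont_diff k u"
  ultimately obtain u' where "\<And>x. (u has_real_derivative u' x) (at x)" by auto
  then show ?thesis using DERIV_isCont continuous_at_imp_continuous_on by blast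
qed (auto intro: continuous_on_subset)

lemma cont_diff_SucD: "cont_diff (Suc k) u \<Longrightarrow> cont_diff k u"
proof (induction k arbitrary: u)
  case 0
  then show ?case using cont_diff_continuous by (metis cont_diff.simps(1))
next
  case (Suc k)
  then show ?case by (metis cont_diff.simps(2))
qed

lemma cont_diff_mono: "cont_diff k u \<Longrightarrow> j \<le> k \<Longrightarrow> cont_diff j u"
  by (induction k) (use cont_diff_SucD le_Suc_eq in blast)+

section \<open>Closure under algebraic operations and composition\<close>

lemma cont_diff_const: "cont_diff k (\<lambda>x. c)"
proof (induction k arbitrary: c)
  case (Suc k)
  show ?case by (rule cont_diff_SucI[OF DERIV_const Suc.IH])
qed simp

lemma cont_diff_ident: "cont_diff k (\<lambda>x. x)"
proof (cases k)
  case (Suc m)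
  show ?thesis unfolding Suc by (rule cont_diff_SucI[OF DERIV_ident cont_diff_const])
qed simp

lemma cont_diff_add: "cont_diff k u \<Longrightarrow> cont_diff k v \<Longrightarrow> cont_diff k (\<lambda>x. u x + v x)"
proof (induction k arbitrary: u v)
  case (Suc k)
  then obtain u' v' where "\<And>x. (u has_real_derivative u' x) (at x)" "cont_diff k u'"
    "\<And>x. (v has_real_derivative v' x) (at x)" "cont_diff k v'" by auto
  then show ?case by (intro cont_diff_SucI[of _ "\<lambda>x. u' x + v' x"] DERIV_add Suc.IH)
qed (auto intro: continuous_intros)

lemma cont_diff_mult: "cont_diff k u \<Longrightarrow> cont_diff k v \<Longrightarrow> cont_diff k (\<lambda>x. u x * v x)"
proof (induction k arbitrary: u v)
  case (Suc k)
  then obtain u' v' where *: "\<And>x. (u has_real_derivative u' x) (at x)" "cont_diff k u'"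
    "\<And>x. (v has_real_derivative v' x) (at x)" "cont_diff k v'" by auto
  have "cont_diff k u" "cont_diff k v" using Suc.prems cont_diff_SucD by blast+
  then show ?case
    by (intro cont_diff_SucI[of _ "\<lambda>x. u' x * v x + v' x * u x"] DERIV_mult * cont_diff_add Suc.IH)
qed (auto intro: continuous_intros)

lemma cont_diff_compose: "cont_diff k u \<Longrightarrow> cont_diff k v \<Longrightarrow> cont_diff k (\<lambda>x. u (v x))"
proof (induction k arbitrary: u v)
  case 0
  then show ?case by (auto intro: continuous_on_compose2)
next
  case (Suc k)
  then obtain u' v' where *: "\<And>x. (u has_real_derivative u' x) (at x)" "cont_diff k u'"
    "\<And>x. (v has_real_derivative v' x) (at x)" "cont_diff k v'" by auto
  have v: "cont_diff k v" using Suc.prems cont_diff_SucD by blast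
  show ?case
    by (rule cont_diff_SucI[OF DERIV_chain2[OF *(1) *(3)] cont_diff_mult[OF Suc.IH[OF *(2) v] *(4)]])
qed

lemma cont_diff_exp: "cont_diff k (exp :: real \<Rightarrow> real)"
proof (induction k)
  case (Suc k)
  show ?case by (rule cont_diff_SucI[OF DERIV_exp Suc.IH])
qed (simp add: continuous_on_exp)

lemma cont_diff_inverse:
  "cont_diff k u \<Longrightarrow> (\<And>x. u x \<noteq> 0) \<Longrightarrow> cont_diff k (\<lambda>x. inverse (u x))"
proof (induction k arbitrary: u)
  case 0
  then show ?case by (auto intro: continuous_intros)
next
  case (Suc k)
  then obtain u' where *: "\<And>x. (u has_real_derivative u' x) (at x)" "cont_diff k u'" by auto
  have "cont_diff k u" using Suc.prems cont_diff_SucD by blast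
  with Suc.prems Suc.IH have inv: "cont_diff k (\<lambda>x. inverse (u x))" by blast
  show ?case
  proof (rule cont_diff_SucI[of _ "\<lambda>x. (- 1) * (u' x * (inverse (u x) * inverse (u x)))"])
    show "((\<lambda>x. inverse (u x)) has_real_derivative
        (- 1) * (u' x * (inverse (u x) * inverse (u x)))) (at x)" for x
      by (rule derivative_eq_intros * Suc.prems refl)+ (simp add: mult.commute mult.left_commute)
    show "cont_diff k (\<lambda>x. (- 1) * (u' x * (inverse (u x) * inverse (u x))))"
      by (intro cont_diff_mult cont_diff_const * inv)
  qed
qed

lemma cont_diff_ln:
  assumes "cont_diff (Suc k) u" "\<And>x. u x > 0"
  shows "cont_diff (Suc k) (\<lambda>x. ln (u x))"
proof -
  obtain u' where *: "\<And>x. (u has_real_derivative u' x) (at x)" "cont_diff k u'"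
    using assms by auto
  show ?thesis
  proof (rule cont_diff_SucI[of _ "\<lambda>x. inverse (u x) * u' x"])
    show "((\<lambda>x. ln (u x)) has_real_derivative inverse (u x) * u' x) (at x)" for x
      by (rule derivative_eq_intros * assms refl)+ (simp add: field_simps)
    show "cont_diff k (\<lambda>x. inverse (u x) * u' x)"
      using assms(2) by (intro cont_diff_mult cont_diff_inverse * cont_diff_SucD[OF assms(1)])
        (simp add: less_imp_neq[THEN not_sym])
  qed
qed

section \<open>Inverse functions and termwise differentiation\<close>

text \<open>A right inverse is enough: \<open>u\<close> is strictly increasing, so \<open>v\<close>
  is its two-sided inverse and continuous, and the inverse function rule applies.\<close>

lemma DERIV_inverse_bij:
  fixes u :: "real \<Rightarrow> real"
  assumes u: "\<And>x. (u has_real_derivative u' x) (at x)" "\<And>x. u' x > 0" and uv: "\<And>x. u (v x) = x"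
  shows "(v has_real_derivative inverse (u' (v x))) (at x)"
proof -
  have mono: "strict_mono u"
  proof (rule strict_monoI)
    fix x y :: real
    assume "x < y"
    then show "u x < u y" using u DERIV_pos_imp_increasing by blast
  qed
  then have vu: "v (u x) = x" for x using uv[of "u x"] strict_mono_eq by blast
  have "isCont v (u y)" for y
    by (rule isCont_inverse_function2[of "y - 1" _ "y + 1" v u])
      (use DERIV_isCont[OF u(1)] vu in auto)
  then have "isCont v x" using uv by metis
  then show ?thesis
    using u uv by (intro DERIV_inverse_function[of u _ _ _ "x - 1" "x + 1"]) (auto simp: less_imp_neq[THEN not_sym])
qed

text \<open>Bootstrapping: the derivative of \<open>v\<close> is the inverse of
  \<open>deriv u (v x)\<close>, which is as smooth as \<open>v\<close> itself, so each step of the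
  induction on \<open>j\<close> gains one order.\<close>

lemma cont_diff_inverse_bij:
  assumes "cont_diff (Suc k) u" and pos: "\<And>x. deriv u x > 0" and uv: "\<And>x. u (v x) = x"
  shows "cont_diff (Suc k) v"
proof -
  have u: "\<And>x. (u has_real_derivative deriv u x) (at x)" "cont_diff k (deriv u)"
    using assms(1) unfolding cont_diff_Suc_deriv by auto
  note v = DERIV_inverse_bij[OF u(1) pos uv]
  have "cont_diff j v" if "j \<le> Suc k" for j
    using that
  proof (induction j)
    case 0
    then show ?case using DERIV_isCont[OF v] by (simp add: continuous_at_imp_continuous_on)
  next
    case (Suc j)
    have "cont_diff j (\<lambda>x. inverse (deriv u (v x)))"
    proof (rule cont_diff_inverse)
      show "cont_diff j (\<lambda>x. deriv u (v x))"
        by (rule cont_diff_compose[OF cont_diff_mono[OF u(2)]]) (use Suc in simp_all)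
      show "deriv u (v x) \<noteq> 0" for x
        using pos[of "v x"] by simp
    qed
    then show ?case by (rule cont_diff_SucI[OF v])
  qed
  then show ?thesis by blast
qed

text \<open>A locally uniform M-test: it asks for summable bounds on the derivatives over every
  interval \<open>{-R..R}\<close> and for convergence of the series at \<open>0\<close>.\<close>

lemma series_termwise_differentiable:
  fixes t t' :: "nat \<Rightarrow> real \<Rightarrow> real"
  assumes der: "\<And>n x. (t n has_real_derivative t' n x) (at x)"
    and cont: "\<And>n. continuous_on UNIV (t' n)"
    and bound: "\<And>R. R > 0 \<Longrightarrow> \<exists>M. summable M \<and> (\<forall>n x. \<bar>x\<bar> \<le> R \<longrightarrow> \<bar>t' n x\<bar> \<le> M n)"
    and sum0: "summable (\<lambda>n. t n 0)"
  shows "summable (\<lambda>n. t n x)"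
    and "((\<lambda>x. \<Sum>n. t n x) has_real_derivative (\<Sum>n. t' n x)) (at x)"
    and "continuous_on UNIV (\<lambda>x. \<Sum>n. t' n x)"
proof -
  have unif: "uniform_limit {-R..R} (\<lambda>n x. \<Sum>i<n. t' i x) (\<lambda>x. \<Sum>n. t' n x) sequentially"
    if R: "R > 0" for R
  proof -
    obtain M where M: "summable M" "\<forall>n x. \<bar>x\<bar> \<le> R \<longrightarrow> \<bar>t' n x\<bar> \<le> M n"
      using bound[OF R] by (elim exE conjE)
    then show ?thesis by (intro Weierstrass_m_test[OF _ M(1)]) auto
  qed
  have x: "x \<in> interior {-(\<bar>x\<bar>+1)..\<bar>x\<bar>+1}" for x :: real by auto
  note * = has_field_derivative_series'[of "{-(\<bar>x\<bar>+1)..\<bar>x\<bar>+1}" t t' 0 x, OF _ _ _ _ sum0 x]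
  have "uniformly_convergent_on {-(\<bar>x\<bar>+1)..\<bar>x\<bar>+1} (\<lambda>n x. \<Sum>i<n. t' i x)"
    using unif[of "\<bar>x\<bar>+1"] uniformly_convergentI by force
  note * = *[OF _ _ this]
  show "summable (\<lambda>n. t n x)"
    by (rule *(1)) (auto intro: der has_field_derivative_at_within)
  show "((\<lambda>x. \<Sum>n. t n x) has_real_derivative (\<Sum>n. t' n x)) (at x)"
    by (rule *(2)) (auto intro: der has_field_derivative_at_within)
  have "isCont (\<lambda>x. \<Sum>n. t' n x) x" for x
  proof (rule continuous_on_interior[OF _ x])
    show "continuous_on {-(\<bar>x\<bar>+1)..\<bar>x\<bar>+1} (\<lambda>x. \<Sum>n. t' n x)"
      by (rule uniform_limit_theorem[OF _ unif])
        (auto intro!: always_eventually continuous_on_sum continuous_on_subset[OF cont])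
  qed
  then show "continuous_on UNIV (\<lambda>x. \<Sum>n. t' n x)"
    by (simp add: continuous_at_imp_continuous_on)
qed

lemma bounded_on_cball_real:
  assumes "continuous_on UNIV (u :: real \<Rightarrow> real)"
  obtains B where "B > 0" "\<And>x. \<bar>x\<bar> \<le> R \<Longrightarrow> \<bar>u x\<bar> \<le> B"
proof -
  have "compact (u ` {-R..R})"
    by (intro compact_continuous_image continuous_on_subset[OF assms]) auto
  then obtain B where "B > 0" "\<forall>y\<in>u ` {-R..R}. norm y \<le> B"
    using bounded_pos compact_imp_bounded by metis
  then show ?thesis by (intro that[of B]) (auto simp: abs_le_iff)
qed

section \<open>Regularity of solutions of a linear functional equation\<close>

text \<open>Iterating the equation writes \<open>T\<close> as the series of \<open>t n\<close>,
  where \<open>t n x\<close> is \<open>q ((G ^^ n) x)\<close> times \<open>n\<close> values of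
  \<open>a\<close>; it converges geometrically. The derivative of \<open>T\<close> solves an
  equation of the same kind with coefficient \<open>a x * deriv G x\<close>, still bounded by
  \<kappa> because \<open>deriv G\<close> is at most 1 in absolute value. Induction on
  \<open>m\<close> thus raises the regularity of \<open>T\<close> to that of the data.\<close>

lemma cont_diff_functional_equation:
  fixes a q T G :: "real \<Rightarrow> real"
  assumes "cont_diff m a" "cont_diff m q" "cont_diff m G" "continuous_on UNIV T"
    and G: "\<And>x. \<bar>G x\<bar> \<le> \<bar>x\<bar>" "\<And>x. \<bar>deriv G x\<bar> \<le> 1"
    and a: "\<And>x. \<bar>a x\<bar> \<le> \<kappa>" "\<kappa> < 1"
    and T: "\<And>x. T x = a x * T (G x) + q x"
  shows "cont_diff m T"
  using assms
proof (induction m arbitrary: a q T)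
  case 0
  show ?case using 0(4) by simp
next
  case (Suc m)
  note T = Suc.prems(9) and a = Suc.prems(7)
  have IH: "cont_diff m T"
    by (rule Suc.IH[of a q T, OF Suc.prems(1-3)[THEN cont_diff_SucD] Suc.prems(4-9)])
  obtain a' q' where a': "\<And>x. (a has_real_derivative a' x) (at x)" "cont_diff m a'"
    and q': "\<And>x. (q has_real_derivative q' x) (at x)" "cont_diff m q'"
    using Suc.prems(1,2) by auto
  define G' where "G' = deriv G"
  have G': "\<And>x. (G has_real_derivative G' x) (at x)" "cont_diff m G'" "\<And>x. \<bar>G' x\<bar> \<le> 1"
    using Suc.prems(3) G(2) unfolding cont_diff_Suc_deriv G'_def by auto
  have \<kappa>0: "0 \<le> \<kappa>" using a[of 0] by linarith
  \<comment> \<open>The recursion for \<open>t'\<close> adds a term of order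
    \<open>\<kappa> ^ n\<close> at each step, which leads to bounds like
    \<open>n * \<kappa> ^ n\<close>; a rate strictly between \<kappa> and 1 absorbs the factor
    \<open>n\<close>.\<close>
  define \<rho> where "\<rho> = (\<kappa> + 1) / 2"
  have \<rho>: "\<kappa> < \<rho>" "\<rho> < 1" "0 < \<rho>" using \<open>\<kappa> < 1\<close> \<kappa>0 by (auto simp: \<rho>_def)

  define t where "t = rec_nat q (\<lambda>n u x. a x * u (G x))"
  have t0: "t 0 = q" and tS: "t (Suc n) = (\<lambda>x. a x * t n (G x))" for n
    by (auto simp: t_def)
  define t' where "t' = rec_nat q' (\<lambda>n u x. a' x * t n (G x) + (u (G x) * G' x) * a x)"
  have t'0: "t' 0 = q'" and t'S: "t' (Suc n) = (\<lambda>x. a' x * t n (G x) + (t' n (G x) * G' x) * a x)" for n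
    by (auto simp: t'_def)
  have cont: "continuous_on UNIV G" "continuous_on UNIV G'" "continuous_on UNIV a"
    "continuous_on UNIV a'" "continuous_on UNIV q" "continuous_on UNIV q'"
    using cont_diff_continuous Suc.prems(1-3) a'(2) q'(2) G'(2) by blast+
  have der: "(t n has_real_derivative t' n x) (at x)" for n x
  proof (induction n arbitrary: x)
    case (Suc n)
    show ?case unfolding tS t'S by (intro DERIV_mult a' DERIV_chain2[OF Suc G'(1)])
  qed (simp add: t0 t'0 q')
  have cont_t: "continuous_on UNIV (t n)" for n
    using DERIV_isCont[OF der] by (simp add: continuous_at_imp_continuous_on)
  have cont_t': "continuous_on UNIV (t' n)" for n
  proof (induction n)
    case (Suc n)
    show ?case unfolding t'S
      by (intro continuous_intros cont continuous_on_compose2[OF cont_t cont(1)]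
          continuous_on_compose2[OF Suc cont(1)]) auto
  qed (simp add: t'0 cont)

  have t_bound: "\<bar>t n x\<bar> \<le> \<kappa> ^ n * Q" if "\<bar>x\<bar> \<le> R" "\<And>x. \<bar>x\<bar> \<le> R \<Longrightarrow> \<bar>q x\<bar> \<le> Q" for n x R Q
    using that(1)
  proof (induction n arbitrary: x)
    case (Suc n)
    have "\<bar>t n (G x)\<bar> \<le> \<kappa> ^ n * Q" using Suc G(1)[of x] by (intro Suc.IH) linarith
    then have "\<bar>a x\<bar> * \<bar>t n (G x)\<bar> \<le> \<kappa> * (\<kappa> ^ n * Q)"
      using a[of x] \<kappa>0 by (intro mult_mono) auto
    then show ?case by (simp add: tS abs_mult mult.assoc)
  qed (use that in \<open>simp add: t0\<close>)
  have t'_bound: "\<exists>M. summable M \<and> (\<forall>n x. \<bar>x\<bar> \<le> R \<longrightarrow> \<bar>t' n x\<bar> \<le> M n)" for R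
  proof -
    obtain Q where Q: "Q > 0" "\<And>x. \<bar>x\<bar> \<le> R \<Longrightarrow> \<bar>q x\<bar> \<le> Q"
      using bounded_on_cball_real[OF cont(5)] by metis
    obtain Q' where Q': "Q' > 0" "\<And>x. \<bar>x\<bar> \<le> R \<Longrightarrow> \<bar>q' x\<bar> \<le> Q'"
      using bounded_on_cball_real[OF cont(6)] by metis
    obtain A where A: "A > 0" "\<And>x. \<bar>x\<bar> \<le> R \<Longrightarrow> \<bar>a' x\<bar> \<le> A"
      using bounded_on_cball_real[OF cont(4)] by metis
    \<comment> \<open>Chosen so that \<open>A * Q + \<kappa> * B \<le> \<rho> * B\<close>, which is
      what the induction step for the bound \<open>\<rho> ^ n * B\<close> requires.\<close>
    define B where "B = Q' + A * Q / (\<rho> - \<kappa>)"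
    have "A * Q / (\<rho> - \<kappa>) \<ge> 0" using A Q \<rho> by simp
    then have B: "Q' \<le> B" "0 < B" using Q' by (auto simp: B_def)
    have "A * Q = (A * Q / (\<rho> - \<kappa>)) * (\<rho> - \<kappa>)" using \<rho> by simp
    also have "\<dots> \<le> B * (\<rho> - \<kappa>)" using \<rho> Q' by (intro mult_right_mono) (auto simp: B_def)
    finally have B': "A * Q + \<kappa> * B \<le> \<rho> * B" by (simp add: algebra_simps)
    have "\<bar>t' n x\<bar> \<le> \<rho> ^ n * B" if "\<bar>x\<bar> \<le> R" for n x
      using that
    proof (induction n arbitrary: x)
      case 0
      then show ?case using Q'(2)[of x] B by (simp add: t'0)
    next
      case (Suc n)
      have Gx: "\<bar>G x\<bar> \<le> R" using Suc.prems G(1)[of x] by linarith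
      have "\<bar>a' x * t n (G x)\<bar> \<le> A * (\<kappa> ^ n * Q)"
        unfolding abs_mult using A(2)[OF Suc.prems] t_bound[OF Gx Q(2)] A(1) by (intro mult_mono) auto
      also have "\<dots> \<le> A * (\<rho> ^ n * Q)"
        using \<rho> \<kappa>0 A Q by (intro mult_left_mono mult_right_mono power_mono) auto
      finally have 1: "\<bar>a' x * t n (G x)\<bar> \<le> \<rho> ^ n * (A * Q)" by (simp add: mult_ac)
      have "\<bar>t' n (G x) * G' x\<bar> \<le> (\<rho> ^ n * B) * 1"
        unfolding abs_mult using Suc.IH[OF Gx] G'(3)[of x] B \<rho> by (intro mult_mono) auto
      then have "\<bar>(t' n (G x) * G' x) * a x\<bar> \<le> (\<rho> ^ n * B) * \<kappa>"
        unfolding abs_mult[of _ "a x"] using a[of x] B \<rho> by (intro mult_mono) auto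
      with 1 have "\<bar>t' (Suc n) x\<bar> \<le> \<rho> ^ n * (A * Q) + \<rho> ^ n * (\<kappa> * B)"
        unfolding t'S by (simp add: mult_ac)
      also have "\<dots> = \<rho> ^ n * (A * Q + \<kappa> * B)" by (simp add: algebra_simps)
      also have "\<dots> \<le> \<rho> ^ n * (\<rho> * B)" using B' \<rho> by (intro mult_left_mono) auto
      finally show ?case by (simp add: mult_ac)
    qed
    moreover have "summable (\<lambda>n. \<rho> ^ n * B)" using \<rho> by (intro summable_mult2 summable_geometric) auto
    ultimately show ?thesis by blast
  qed
  have T_sums: "(\<lambda>n. t n x) sums T x" for x
  proof -
    obtain K where K: "K > 0" "\<And>y. \<bar>y\<bar> \<le> \<bar>x\<bar> \<Longrightarrow> \<bar>T y\<bar> \<le> K"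
      using bounded_on_cball_real[OF Suc.prems(4)] by metis
    \<comment> \<open>Up to sign, the remainder is \<open>T ((G ^^ N) y)\<close> times
      \<open>N\<close> values of \<open>a\<close>; \<open>G\<close> does not increase absolute
      values, so the bound \<open>K\<close> persists along the orbit.\<close>
    have rem: "\<bar>(\<Sum>i<N. t i y) - T y\<bar> \<le> \<kappa> ^ N * K" if "\<bar>y\<bar> \<le> \<bar>x\<bar>" for N y
      using that
    proof (induction N arbitrary: y)
      case 0
      then show ?case using K by simp
    next
      case (Suc N)
      have "(\<Sum>i<Suc N. t i y) - T y = a y * ((\<Sum>i<N. t i (G y)) - T (G y))"
        unfolding sum.lessThan_Suc_shift T[of y] by (simp add: t0 tS sum_distrib_left algebra_simps)
      moreover have "\<bar>(\<Sum>i<N. t i (G y)) - T (G y)\<bar> \<le> \<kappa> ^ N * K"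
        using Suc.prems G(1)[of y] by (intro Suc.IH) linarith
      then have "\<bar>a y\<bar> * \<bar>(\<Sum>i<N. t i (G y)) - T (G y)\<bar> \<le> \<kappa> * (\<kappa> ^ N * K)"
        using a[of y] \<kappa>0 by (intro mult_mono) auto
      ultimately show ?case by (simp add: abs_mult mult.assoc)
    qed
    have "(\<lambda>N. \<kappa> ^ N * K) \<longlonglongrightarrow> 0 * K"
      using \<kappa>0 \<open>\<kappa> < 1\<close> by (intro tendsto_mult_right LIMSEQ_power_zero) auto
    then have "(\<lambda>N. \<kappa> ^ N * K) \<longlonglongrightarrow> 0" by simp
    then have "(\<lambda>N. (\<Sum>i<N. t i x) - T x) \<longlonglongrightarrow> 0"
      by (rule Lim_null_comparison[rotated]) (simp add: rem)
    then show ?thesis unfolding sums_def by (simp add: LIM_zero_iff)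
  qed
  then have T_eq: "T = (\<lambda>x. \<Sum>n. t n x)" by (auto simp: sums_iff)
  define S where "S = (\<lambda>x. \<Sum>n. t' n x)"
  have "summable (\<lambda>n. t n 0)" using T_sums sums_summable by blast
  note series = series_termwise_differentiable[OF der cont_t' t'_bound this, folded T_eq]
  have S: "(T has_real_derivative S x) (at x)" for x
    using series(2) unfolding S_def .
  have "cont_diff m S"
  proof (rule Suc.IH[of "\<lambda>x. a x * G' x" "\<lambda>x. a' x * T (G x) + q' x"])
    have "cont_diff m a" "cont_diff m G" using Suc.prems(1,3) cont_diff_SucD by blast+
    then show "cont_diff m (\<lambda>x. a x * G' x)" "cont_diff m (\<lambda>x. a' x * T (G x) + q' x)" "cont_diff m G"
      using cont_diff_mult[OF _ G'(2)] cont_diff_compose[OF IH]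
        cont_diff_add[OF cont_diff_mult[OF a'(2)] q'(2)] by blast+
    show "continuous_on UNIV S" using series(3) unfolding S_def .
    show "\<bar>a x * G' x\<bar> \<le> \<kappa>" for x
      using mult_mono[OF a[of x] G'(3)[of x]] \<kappa>0 by (simp add: abs_mult)
    have "((\<lambda>x. a x * T (G x) + q x) has_real_derivative
        (a' x * T (G x) + (S (G x) * G' x) * a x) + q' x) (at x)" for x
      by (intro DERIV_add DERIV_mult a' q' DERIV_chain2[OF S G'(1)])
    then have "(T has_real_derivative (a' x * T (G x) + (S (G x) * G' x) * a x) + q' x) (at x)" for x
      unfolding T[symmetric] .
    then show "S x = a x * G' x * S (G x) + (a' x * T (G x) + q' x)" for x
      using DERIV_unique[OF S] by (fastforce simp: algebra_simps)
  qed (use G \<open>\<kappa> < 1\<close> in auto)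
  then show ?case using S by (rule cont_diff_SucI[rotated])
qed

section \<open>Lifts of expanding maps\<close>

lemma shift_of_periodic_derivative:
  fixes u :: "real \<Rightarrow> real"
  assumes u: "\<And>x. (u has_real_derivative v x) (at x)" and v: "\<And>x. v (x + 1) = v x"
  shows "u (x + 1) = u x + (u 1 - u 0)"
proof -
  have "((\<lambda>x. u (x + 1) - u x) has_real_derivative v (x + 1) - v x) (at x)" for x
    by (rule DERIV_diff[OF DERIV_shift[THEN iffD1, OF u] u])
  then have "((\<lambda>x. u (x + 1) - u x) has_real_derivative 0) (at x)" for x by (simp add: v)
  then have "u (x + 1) - u x = u (0 + 1) - u 0"
    by (rule DERIV_isconst_all[rule_format, of "\<lambda>x. u (x + 1) - u x"])
  then show ?thesis by simp
qed

lemma periodic_of_int: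
  fixes u :: "real \<Rightarrow> 'a"
  assumes "\<And>x. u (x + 1) = u x"
  shows "u (x + of_int k) = u x"
proof (induction k rule: int_induct[where k = 0])
  case (step1 i)
  then show ?case using assms[of "x + of_int i"] by (simp add: add.assoc)
next
  case (step2 i)
  then show ?case using assms[of "x + of_int (i - 1)"] by simp
qed simp

lemma periodic_frac:
  fixes u :: "real \<Rightarrow> 'a"
  assumes "\<And>x. u (x + 1) = u x"
  shows "u (frac x) = u x"
  using periodic_of_int[of u "frac x" "\<lfloor>x\<rfloor>", OF assms] by (simp add: frac_def)

lemma add_of_int_equivariant:
  fixes u :: "real \<Rightarrow> real"
  assumes "\<And>x. u (x + 1) = u x + c"
  shows "u (x + of_int k) = u x + of_int k * c"
proof (induction k rule: int_induct[where k = 0])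
  case (step1 i)
  then show ?case using assms[of "x + of_int i"] by (simp add: add.assoc algebra_simps)
next
  case (step2 i)
  then show ?case using assms[of "x + of_int (i - 1)"] by (simp add: algebra_simps)
qed simp

lemma deriv_add_equivariant:
  fixes u :: "real \<Rightarrow> real"
  assumes "\<And>x. (u has_real_derivative deriv u x) (at x)" and "\<And>x. u (x + s) = u x + c"
  shows "deriv u (x + s) = deriv u x"
proof -
  have "((\<lambda>x. u (x + s)) has_real_derivative deriv u (x + s)) (at x)"
    using assms(1) by (rule DERIV_shift[THEN iffD1])
  moreover have "((\<lambda>x. u x + c) has_real_derivative deriv u x) (at x)"
    using DERIV_add[OF assms(1) DERIV_const] by simp
  ultimately show ?thesis unfolding assms(2) by (rule DERIV_unique)
qed

lemma surj_of_integers: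
  fixes u :: "real \<Rightarrow> real"
  assumes "continuous_on UNIV u" "c \<ge> 1" "\<And>k. u (of_int k) = of_int k * c"
  shows "\<exists>x. u x = y"
proof -
  define N where "N = \<lceil>\<bar>y\<bar>\<rceil>"
  have N: "\<bar>y\<bar> \<le> of_int N" "of_int N \<ge> (0::real)" by (auto simp: N_def)
  have *: "of_int N * 1 \<le> of_int N * c" using N assms(2) by (intro mult_left_mono) auto
  have "\<exists>x\<ge>of_int (-N). x \<le> of_int N \<and> u x = y"
  proof (rule IVT')
    show "u (of_int (-N)) \<le> y" "y \<le> u (of_int N)"
      unfolding assms(3) using N * by (auto simp: abs_le_iff)
    show "real_of_int (-N) \<le> of_int N" using N by simp
    show "continuous_on {real_of_int (-N)..of_int N} u"
      using assms(1) continuous_on_subset by blast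
  qed
  then show ?thesis by blast
qed

text \<open>The situation on the line. Two continuous derivatives of \<open>F\<close> make \<psi>
  continuously differentiable, as the termwise differentiation of \<omega> requires.\<close>

locale expanding_lift =
  fixes F :: "real \<Rightarrow> real" and d :: nat
  assumes d: "d \<ge> 2" and F0: "F 0 = 0" and F_shift: "\<And>x. F (x + 1) = F x + real d"
    and F_C2: "cont_diff 2 F" and F_gt1: "\<And>x. deriv F x > 1"
begin

definition G :: "real \<Rightarrow> real" where "G = inv F"
definition \<psi> :: "real \<Rightarrow> real" where "\<psi> x = ln (deriv F x)"
definition \<Lambda> :: real where "\<Lambda> = \<psi> 0"
text \<open>The exponential of \<open>-\<omega>\<close> is the derivative of the linearization of \<open>F\<close> at its
  fixed point \<open>0\<close>.\<close>

definition \<omega> :: "real \<Rightarrow> real" where "\<omega> x = (\<Sum>n. \<psi> ((G ^^ Suc n) x) - \<Lambda>)"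

section \<open>The lift, its inverse and uniform contraction\<close>

lemma F_C1: "cont_diff (Suc 0) F" and F'_C1: "cont_diff (Suc 0) (deriv F)"
  and F_der: "(F has_real_derivative deriv F x) (at x)"
  using F_C2 cont_diff_SucD[of "Suc 0" F] cont_diff_Suc_deriv[of "Suc 0" F]
  by (simp_all add: numeral_2_eq_2 del: cont_diff.simps)

lemma F'_shift: "deriv F (x + 1) = deriv F x"
  by (rule deriv_add_equivariant[OF F_der F_shift])

lemma F_int: "F (x + of_int k) = F x + of_int (k * int d)"
  using add_of_int_equivariant[of F "real d", OF F_shift] by simp

lemma F_mono: "strict_mono F"
proof (rule strict_monoI)
  fix x y :: real
  assume "x < y"
  moreover have "0 < deriv F z" for z using F_gt1[of z] by linarith
  ultimately show "F x < F y" using F_der DERIV_pos_imp_increasing by blast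
qed

lemma FG: "F (G x) = x"
proof -
  have "F (of_int k) = of_int k * real d" for k
    using F_int[of 0 k] F0 by simp
  then have "\<exists>y. F y = x"
    using surj_of_integers[OF cont_diff_continuous[OF F_C1], of "real d"] d by simp
  then show ?thesis unfolding G_def by (metis f_inv_into_f rangeI)
qed

lemma GF: "G (F x) = x"
  unfolding G_def by (rule inv_f_f[OF strict_mono_imp_inj_on[OF F_mono]])

lemma G0: "G 0 = 0" using GF[of 0] F0 by simp

lemma G_int: "G (x + of_int (k * int d)) = G x + of_int k"
  using GF[of "G x + of_int k"] F_int[of "G x" k] by (simp add: FG)

lemma F'_pos: "deriv F x > 0" using F_gt1[of x] by linarith

lemma G_der: "(G has_real_derivative inverse (deriv F (G x))) (at x)"
  by (rule DERIV_inverse_bij[OF F_der F'_pos FG])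

lemma G_C: "cont_diff (Suc k) F \<Longrightarrow> cont_diff (Suc k) G"
  by (rule cont_diff_inverse_bij[OF _ F'_pos FG])

lemma deriv_G: "deriv G x = inverse (deriv F (G x))"
  using G_der by (rule DERIV_imp_deriv)

text \<open>\<open>deriv F\<close> is periodic, so its minimum over \<open>{0..1}\<close> is a
  global one; the pointwise bound \<open>deriv F x > 1\<close> thus becomes uniform.\<close>

lemma contraction_rate: "\<exists>\<kappa>. 0 < \<kappa> \<and> \<kappa> < 1 \<and> (\<forall>x. deriv G x \<le> \<kappa>)"
proof -
  have "\<exists>x\<in>{0..1}. \<forall>y\<in>{0..1}. deriv F x \<le> deriv F y"
    by (intro continuous_attains_inf continuous_on_subset[OF cont_diff_continuous[OF F'_C1]]) auto
  then obtain x where x: "\<And>y. y \<in> {0..1} \<Longrightarrow> deriv F x \<le> deriv F y" by blast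
  have "deriv F x \<le> deriv F y" for y
    using x[of "frac y"] periodic_frac[of "deriv F" y] F'_shift frac_lt_1[of y] frac_ge_0[of y] by simp
  then have "deriv G y \<le> inverse (deriv F x)" for y
    unfolding deriv_G by (intro le_imp_inverse_le F'_pos)
  then show ?thesis
    using F'_pos[of x] F_gt1[of x] by (intro exI[of _ "inverse (deriv F x)"]) (auto simp: inverse_less_1_iff)
qed

definition \<kappa> :: real where "\<kappa> = (SOME \<kappa>. 0 < \<kappa> \<and> \<kappa> < 1 \<and> (\<forall>x. deriv G x \<le> \<kappa>))"

lemma \<kappa>: "0 < \<kappa>" "\<kappa> < 1" "deriv G x \<le> \<kappa>"
  using someI_ex[OF contraction_rate] unfolding \<kappa>_def by blast+

lemma deriv_G_pos: "0 < deriv G x" unfolding deriv_G using F'_pos by simp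

lemma G_der': "(G has_real_derivative deriv G x) (at x)" using G_der deriv_G by simp

section \<open>Iterates of the inverse and of the lift\<close>

lemma Gn_der: "\<exists>D. ((G ^^ n) has_real_derivative D) (at x) \<and> 0 < D \<and> D \<le> \<kappa> ^ n"
proof (induction n)
  case 0
  show ?case by (rule exI[of _ 1]) (auto simp: DERIV_ident id_def)
next
  case (Suc n)
  then obtain D where D: "((G ^^ n) has_real_derivative D) (at x)" "0 < D" "D \<le> \<kappa> ^ n" by blast
  have "((G ^^ Suc n) has_real_derivative deriv G ((G ^^ n) x) * D) (at x)"
    using DERIV_chain[OF G_der' D(1)] by (simp add: o_def)
  moreover have "deriv G ((G ^^ n) x) * D \<le> \<kappa> * \<kappa> ^ n"
    using D \<kappa> by (intro mult_mono) auto
  ultimately show ?case using D(2) deriv_G_pos by (metis mult_pos_pos power_Suc)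
qed

lemma Gn_mono: "strict_mono (G ^^ n)"
proof (rule strict_monoI)
  fix x y :: real
  assume "x < y"
  then show "(G ^^ n) x < (G ^^ n) y" using Gn_der DERIV_pos_imp_increasing by blast
qed

lemma Gn_0: "(G ^^ n) 0 = 0"
  by (induction n) (auto simp: G0)

lemma Gn_Lipschitz: "\<bar>(G ^^ n) x - (G ^^ n) y\<bar> \<le> \<kappa> ^ n * \<bar>x - y\<bar>"
proof -
  obtain D where D: "\<And>x. ((G ^^ n) has_real_derivative D x) (at x)" "\<And>x. 0 < D x" "\<And>x. D x \<le> \<kappa> ^ n"
    using Gn_der by metis
  have "norm ((G ^^ n) x - (G ^^ n) y) \<le> \<kappa> ^ n * norm (x - y)"
  proof (rule field_differentiable_bound[of UNIV _ D])
    show "norm (D z) \<le> \<kappa> ^ n" for z using D(2)[of z] D(3)[of z] by simp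
  qed (use D in auto)
  then show ?thesis by simp
qed

lemma Gn_abs_le: "\<bar>(G ^^ n) x\<bar> \<le> \<kappa> ^ n * \<bar>x\<bar>"
  using Gn_Lipschitz[of n x 0] by (simp add: Gn_0)

lemma Gn_abs_le': "\<bar>(G ^^ n) x\<bar> \<le> \<bar>x\<bar>"
proof -
  have "\<kappa> ^ n * \<bar>x\<bar> \<le> 1 * \<bar>x\<bar>" using \<kappa> by (intro mult_right_mono power_le_one) auto
  then show ?thesis using Gn_abs_le[of n x] by linarith
qed

lemma Fn_Gn: "(F ^^ n) ((G ^^ n) x) = x"
proof (induction n arbitrary: x)
  case (Suc n)
  have "(F ^^ Suc n) ((G ^^ Suc n) x) = F ((F ^^ n) ((G ^^ n) (G x)))"
    by (simp add: funpow_swap1)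
  then show ?case by (simp add: Suc FG)
qed simp

lemma Gn_Fn: "(G ^^ n) ((F ^^ n) x) = x"
proof (induction n arbitrary: x)
  case (Suc n)
  have "(G ^^ Suc n) ((F ^^ Suc n) x) = G ((G ^^ n) ((F ^^ n) (F x)))"
    by (simp add: funpow_swap1)
  then show ?case by (simp add: Suc GF)
qed simp

lemma Fn_int: "(F ^^ n) (x + of_int k) = (F ^^ n) x + of_int (k * int d ^ n)"
proof (induction n)
  case (Suc n)
  then show ?case using F_int[of "(F ^^ n) x" "k * int d ^ n"] by (simp add: mult_ac)
qed simp

section \<open>The potential \<psi> and the transfer function \<omega>\<close>

lemma \<psi>_C: "cont_diff (Suc (Suc k)) F \<Longrightarrow> cont_diff (Suc k) \<psi>"
  unfolding \<psi>_def[abs_def] using cont_diff_Suc_deriv by (intro cont_diff_ln F'_pos) blast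

lemma \<psi>_shift: "\<psi> (x + 1) = \<psi> x" by (simp add: \<psi>_def F'_shift)

lemma \<psi>_C1: "cont_diff (Suc 0) \<psi>"
  using \<psi>_C F_C2 by (simp add: numeral_2_eq_2 del: cont_diff.simps)

lemma \<psi>_der: "(\<psi> has_real_derivative deriv \<psi> x) (at x)"
  using \<psi>_C1 unfolding cont_diff_Suc_deriv by blast

lemma exp_\<psi>: "exp (\<psi> x) = deriv F x"
  unfolding \<psi>_def using F'_pos by simp

lemma \<Lambda>_pos: "\<Lambda> > 0"
  unfolding \<Lambda>_def \<psi>_def using F_gt1[of 0] by (simp add: ln_gt_zero)

lemma \<psi>'_bounded: "\<exists>M. \<forall>x. \<bar>deriv \<psi> x\<bar> \<le> M"
proof -
  have "continuous_on UNIV (deriv \<psi>)" using \<psi>_C1 unfolding cont_diff_Suc_deriv by simp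
  then obtain M where M: "\<And>x. \<bar>x\<bar> \<le> 1 \<Longrightarrow> \<bar>deriv \<psi> x\<bar> \<le> M"
    using bounded_on_cball_real by metis
  have "deriv \<psi> (x + 1) = deriv \<psi> x" for x
    by (rule deriv_add_equivariant[of _ 1 0, OF \<psi>_der]) (simp add: \<psi>_shift)
  then have "\<bar>deriv \<psi> x\<bar> \<le> M" for x
    using M[of "frac x"] periodic_frac[of "deriv \<psi>" x] frac_lt_1[of x] frac_ge_0[of x] by simp
  then show ?thesis by blast
qed

text \<open>The \<open>n\<close>-th term has derivative at most \<open>M * \<kappa> ^ Suc n\<close>
  in absolute value, since \<open>deriv \<psi>\<close> is bounded and \<open>G ^^ Suc n\<close>
  contracts at that rate; at the fixed point \<open>0\<close> all terms vanish.\<close>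

lemma \<omega>_summable: "summable (\<lambda>n. \<psi> ((G ^^ Suc n) x) - \<Lambda>)"
  and \<omega>_der: "(\<omega> has_real_derivative deriv \<omega> x) (at x)"
  and \<omega>_C1: "cont_diff (Suc 0) \<omega>"
proof -
  define t where "t n x = \<psi> ((G ^^ Suc n) x) - \<Lambda>" for n x
  obtain M where M: "\<And>x. \<bar>deriv \<psi> x\<bar> \<le> M" using \<psi>'_bounded by blast
  have Gn_C1: "cont_diff (Suc 0) (G ^^ n)" for n
  proof (induction n)
    case (Suc n)
    then show ?case using cont_diff_compose[OF G_C[OF F_C1] Suc] by (simp add: o_def del: cont_diff.simps)
  qed (simp add: cont_diff_ident id_def del: cont_diff.simps)
  have t_C1: "cont_diff (Suc 0) (t n)" for n
    unfolding t_def[abs_def] diff_conv_add_uminus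
    by (rule cont_diff_add[OF cont_diff_compose[OF \<psi>_C1 Gn_C1] cont_diff_const])
  have bound: "\<bar>deriv (t n) x\<bar> \<le> M * \<kappa> ^ Suc n" for n x
  proof -
    obtain D where D: "((G ^^ Suc n) has_real_derivative D) (at x)" "0 < D" "D \<le> \<kappa> ^ Suc n"
      using Gn_der by blast
    have "(t n has_real_derivative deriv \<psi> ((G ^^ Suc n) x) * D - 0) (at x)"
      unfolding t_def[abs_def] by (intro DERIV_diff DERIV_chain2[OF \<psi>_der D(1)] DERIV_const)
    then have "deriv (t n) x = deriv \<psi> ((G ^^ Suc n) x) * D"
      using DERIV_imp_deriv by fastforce
    moreover have "\<bar>deriv \<psi> ((G ^^ Suc n) x)\<bar> * \<bar>D\<bar> \<le> M * \<kappa> ^ Suc n"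
      using D M by (intro mult_mono) (auto intro: order_trans[OF abs_ge_zero])
    ultimately show ?thesis by (simp add: abs_mult)
  qed
  have "summable (\<lambda>n. M * \<kappa> ^ Suc n)"
    using \<kappa> by (intro summable_mult) (simp add: summable_geometric)
  then have bound': "\<exists>M. summable M \<and> (\<forall>n x. \<bar>x\<bar> \<le> R \<longrightarrow> \<bar>deriv (t n) x\<bar> \<le> M n)" for R
    using bound by blast
  have sum0: "summable (\<lambda>n. t n 0)"
    by (simp add: t_def Gn_0 G0 \<Lambda>_def del: funpow.simps)
  have der: "(t n has_real_derivative deriv (t n) x) (at x)" and cont: "continuous_on UNIV (deriv (t n))" for n x
    using t_C1 unfolding cont_diff_Suc_deriv by auto
  note series = series_termwise_differentiable[OF der cont bound' sum0]
  show "summable (\<lambda>n. \<psi> ((G ^^ Suc n) x) - \<Lambda>)"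
    using series(1) unfolding t_def .
  have "\<omega> = (\<lambda>x. \<Sum>n. t n x)"
    unfolding \<omega>_def[abs_def] t_def ..
  then have "(\<omega> has_real_derivative (\<Sum>n. deriv (t n) x)) (at x)" for x
    using series(2) by simp
  then show C1: "cont_diff (Suc 0) \<omega>"
    using series(3) by (intro cont_diff_SucI) auto
  then show "(\<omega> has_real_derivative deriv \<omega> x) (at x)"
    unfolding cont_diff_Suc_deriv by blast
qed

lemma \<omega>_G: "\<omega> x = \<psi> (G x) - \<Lambda> + \<omega> (G x)"
proof -
  have "(\<Sum>n. \<psi> ((G ^^ Suc (Suc n)) x) - \<Lambda>) = \<omega> x - (\<psi> ((G ^^ Suc 0) x) - \<Lambda>)"
    unfolding \<omega>_def by (rule suminf_split_head[OF \<omega>_summable])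
  moreover have "(\<Sum>n. \<psi> ((G ^^ Suc (Suc n)) x) - \<Lambda>) = \<omega> (G x)"
    unfolding \<omega>_def by (simp add: funpow_swap1)
  ultimately show ?thesis by simp
qed

lemma \<omega>_0: "\<omega> 0 = 0"
  unfolding \<omega>_def by (simp add: Gn_0 G0 \<Lambda>_def del: funpow.simps)

text \<open>On the line, \<psi> is always cohomologous to the constant \<Lambda>. The relation
  descends to the circle only once \<omega> is known to be 1-periodic.\<close>

lemma F'_\<omega>: "deriv F x = exp (\<Lambda> + \<omega> (F x) - \<omega> x)"
  using \<omega>_G[of "F x"] exp_\<psi>[of x] by (simp add: GF)

lemma Fn_der:
  "((F ^^ n) has_real_derivative exp (real n * \<Lambda> + \<omega> ((F ^^ n) x) - \<omega> x)) (at x)"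
proof (induction n)
  case 0
  show ?case by (simp add: id_def)
next
  case (Suc n)
  have "((F ^^ Suc n) has_real_derivative
      deriv F ((F ^^ n) x) * exp (real n * \<Lambda> + \<omega> ((F ^^ n) x) - \<omega> x)) (at x)"
    using DERIV_chain[OF F_der Suc] by (simp add: o_def)
  then show ?case unfolding F'_\<omega> mult_exp_exp by (simp add: algebra_simps o_def)
qed

lemma Gn_der_\<omega>:
  "((G ^^ n) has_real_derivative exp (\<omega> ((G ^^ n) x) - \<omega> x - real n * \<Lambda>)) (at x)"
proof -
  have "((G ^^ n) has_real_derivative
      inverse (exp (real n * \<Lambda> + \<omega> ((F ^^ n) ((G ^^ n) x)) - \<omega> ((G ^^ n) x)))) (at x)"
    by (rule DERIV_inverse_bij[of "F ^^ n"]) (simp_all add: Fn_der Fn_Gn)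
  then show ?thesis by (simp add: Fn_Gn exp_minus[symmetric] algebra_simps)
qed

end

section \<open>Periodic orbits passing twice near the fixed point\<close>

context expanding_lift
begin

text \<open>Such \<open>y\<close> satisfies \<open>F\<^sup>n y = z + 1\<close> and \<open>F\<^sup>m z = y + j\<close>, so it projects to a periodic
  point of period \<open>n + m\<close> whose orbit passes twice close to \<open>0\<close>, at distances about
  \<open>exp (-n \<Lambda>)\<close> and at most about \<open>exp (-m \<Lambda>)\<close>.\<close>

lemma crossing_orbit:
  assumes "n + m \<ge> 1"
  shows "\<exists>y z. (G ^^ n) (z + 1) = y \<and> (G ^^ m) (y + j) = z"
proof -
  have "\<exists>!y\<in>UNIV. (G ^^ n) ((G ^^ m) (y + j) + 1) = y"
  proof (rule Banach_fix)
    show "\<kappa> ^ (n + m) < 1"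
      using \<kappa> assms by (intro power_Suc_less_one[of \<kappa> "n + m - 1", simplified] power_less_one_iff[THEN iffD2]) auto
    fix x y :: real
    have "\<bar>(G ^^ n) ((G ^^ m) (x + j) + 1) - (G ^^ n) ((G ^^ m) (y + j) + 1)\<bar>
        \<le> \<kappa> ^ n * \<bar>(G ^^ m) (x + j) - (G ^^ m) (y + j)\<bar>"
      using Gn_Lipschitz[of n "(G ^^ m) (x + j) + 1" "(G ^^ m) (y + j) + 1"] by simp
    also have "\<dots> \<le> \<kappa> ^ n * (\<kappa> ^ m * \<bar>x - y\<bar>)"
      using Gn_Lipschitz[of m "x + j" "y + j"] \<kappa> by (intro mult_left_mono) auto
    finally show "dist ((G ^^ n) ((G ^^ m) (x + j) + 1)) ((G ^^ n) ((G ^^ m) (y + j) + 1))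
        \<le> \<kappa> ^ (n + m) * dist x y"
      by (simp add: dist_real_def power_add mult.assoc)
  qed (use \<kappa> in \<open>auto simp: complete_UNIV\<close>)
  then show ?thesis by blast
qed

text \<open>Bounded distortion: by the mean value theorem \<open>(G ^^ n) x\<close> is
  \<open>x\<close> times a derivative given by \<open>Gn_der_\<omega>\<close>. Both values of
  \<omega> in it are taken in \<open>{-R..R}\<close>, which the iterates of \<open>G\<close> map
  into itself.\<close>

lemma Gn_size:
  assumes W: "\<And>x. \<bar>x\<bar> \<le> R \<Longrightarrow> \<bar>\<omega> x\<bar> \<le> W" and x: "\<bar>x\<bar> \<le> R"
  shows "exp (- 2 * W) * exp (- real n * \<Lambda>) * \<bar>x\<bar> \<le> \<bar>(G ^^ n) x\<bar>"
    and "\<bar>(G ^^ n) x\<bar> \<le> exp (2 * W) * exp (- real n * \<Lambda>) * \<bar>x\<bar>"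
proof -
  let ?D = "\<lambda>\<xi>. exp (\<omega> ((G ^^ n) \<xi>) - \<omega> \<xi> - real n * \<Lambda>)"
  have "\<exists>\<xi>. \<bar>\<xi>\<bar> \<le> \<bar>x\<bar> \<and> (G ^^ n) x = x * ?D \<xi>"
  proof (cases x "0 :: real" rule: linorder_cases)
    case less
    then obtain \<xi> where "x < \<xi>" "\<xi> < 0" "(G ^^ n) 0 - (G ^^ n) x = (0 - x) * ?D \<xi>"
      using MVT2[of x 0 "G ^^ n" ?D] Gn_der_\<omega> by blast
    then show ?thesis by (intro exI[of _ \<xi>]) (auto simp: Gn_0)
  next
    case greater
    then obtain \<xi> where "0 < \<xi>" "\<xi> < x" "(G ^^ n) x - (G ^^ n) 0 = (x - 0) * ?D \<xi>"
      using MVT2[of 0 x "G ^^ n" ?D] Gn_der_\<omega> by blast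
    then show ?thesis by (intro exI[of _ \<xi>]) (auto simp: Gn_0)
  qed (auto simp: Gn_0)
  then obtain \<xi> where \<xi>: "\<bar>\<xi>\<bar> \<le> \<bar>x\<bar>" "(G ^^ n) x = x * ?D \<xi>" by blast
  have "\<bar>\<omega> \<xi>\<bar> \<le> W" "\<bar>\<omega> ((G ^^ n) \<xi>)\<bar> \<le> W"
    using \<xi> x Gn_abs_le'[of n \<xi>] by (auto intro!: W)
  then have "exp (- 2 * W + - real n * \<Lambda>) \<le> ?D \<xi>" "?D \<xi> \<le> exp (2 * W + - real n * \<Lambda>)"
    by (auto simp: abs_le_iff)
  then have "exp (- 2 * W + - real n * \<Lambda>) * \<bar>x\<bar> \<le> ?D \<xi> * \<bar>x\<bar>"
    "?D \<xi> * \<bar>x\<bar> \<le> exp (2 * W + - real n * \<Lambda>) * \<bar>x\<bar>"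
    by (auto intro!: mult_right_mono)
  then show "exp (- 2 * W) * exp (- real n * \<Lambda>) * \<bar>x\<bar> \<le> \<bar>(G ^^ n) x\<bar>"
    and "\<bar>(G ^^ n) x\<bar> \<le> exp (2 * W) * exp (- real n * \<Lambda>) * \<bar>x\<bar>"
    unfolding \<xi>(2) exp_add by (simp_all add: abs_mult mult.commute)
qed

text \<open>The constants are uniform in \<open>n\<close> and \<open>m\<close>. Contraction first
  confines \<open>y\<close> and \<open>z\<close>, then \<open>Gn_size\<close> on the fixed interval
  of radius \<open>2 + \<bar>j\<bar>\<close> gives the orders. The lower bound concerns
  \<open>y\<close>, which will carry the leading term when lengths are compared.\<close>

lemma crossing_orbit_size:
  "\<exists>c>0. \<exists>C>0. \<exists>N. \<forall>n\<ge>N. \<forall>m\<ge>N. \<forall>y z. (G ^^ n) (z + 1) = y \<longrightarrow> (G ^^ m) (y + j) = z \<longrightarrow>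
     c * exp (- real n * \<Lambda>) \<le> y \<and> y \<le> C * exp (- real n * \<Lambda>) \<and> \<bar>z\<bar> \<le> C * exp (- real m * \<Lambda>)"
proof -
  define R where "R = 2 + \<bar>j\<bar>"
  obtain W where W: "\<And>x. \<bar>x\<bar> \<le> R \<Longrightarrow> \<bar>\<omega> x\<bar> \<le> W"
    using bounded_on_cball_real[OF cont_diff_continuous[OF \<omega>_C1]] by metis
  obtain N where N: "\<kappa> ^ N < 1 / (2 * (1 + \<bar>j\<bar>))"
  proof -
    have "0 < 1 / (2 * (1 + \<bar>j\<bar>))" by (simp add: add_pos_nonneg)
    from real_arch_pow_inv[OF this \<kappa>(2)] that show ?thesis by blast
  qed
  have pow: "\<kappa> ^ n * (1 + \<bar>j\<bar>) \<le> 1 / 2" if "n \<ge> N" for n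
  proof -
    have "\<kappa> ^ n \<le> \<kappa> ^ N" using \<kappa> that by (intro power_decreasing) auto
    then have "\<kappa> ^ n \<le> 1 / (2 * (1 + \<bar>j\<bar>))" using N by linarith
    then have "\<kappa> ^ n * (1 + \<bar>j\<bar>) \<le> 1 / (2 * (1 + \<bar>j\<bar>)) * (1 + \<bar>j\<bar>)"
      by (intro mult_right_mono) auto
    also have "\<dots> = 1 / 2" by (simp add: field_simps)
    finally show ?thesis .
  qed
  have main: "exp (- 2 * W) / 2 * exp (- real n * \<Lambda>) \<le> y \<and> y \<le> exp (2 * W) * R * exp (- real n * \<Lambda>)
      \<and> \<bar>z\<bar> \<le> exp (2 * W) * R * exp (- real m * \<Lambda>)"
    if nm: "n \<ge> N" "m \<ge> N" and y: "(G ^^ n) (z + 1) = y" and z: "(G ^^ m) (y + j) = z" for n m y z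
  proof -
    have "\<kappa> ^ n * 1 \<le> \<kappa> ^ n * (1 + \<bar>j\<bar>)" using \<kappa> by (intro mult_left_mono) auto
    then have "\<kappa> ^ n \<le> 1 / 2" using pow[OF nm(1)] by simp
    then have "\<kappa> ^ n * \<bar>z + 1\<bar> \<le> 1 / 2 * \<bar>z + 1\<bar>" by (intro mult_right_mono) auto
    then have 1: "\<bar>y\<bar> \<le> (\<bar>z\<bar> + 1) / 2" using Gn_abs_le[of n "z + 1"] y by simp
    have "\<bar>y + j\<bar> \<le> (1 + \<bar>j\<bar>) * max 1 \<bar>y\<bar>"
    proof -
      have "\<bar>j\<bar> * 1 \<le> \<bar>j\<bar> * max 1 \<bar>y\<bar>" by (intro mult_left_mono) auto
      then show ?thesis by (simp add: distrib_right) linarith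
    qed
    then have "\<kappa> ^ m * \<bar>y + j\<bar> \<le> \<kappa> ^ m * ((1 + \<bar>j\<bar>) * max 1 \<bar>y\<bar>)"
      using \<kappa> by (intro mult_left_mono) auto
    also have "\<dots> = (\<kappa> ^ m * (1 + \<bar>j\<bar>)) * max 1 \<bar>y\<bar>" by (simp add: mult.assoc)
    also have "\<dots> \<le> 1 / 2 * max 1 \<bar>y\<bar>" by (intro mult_right_mono pow nm) auto
    finally have 2: "\<bar>z\<bar> \<le> max 1 \<bar>y\<bar> / 2" using Gn_abs_le[of m "y + j"] z by simp
    \<comment> \<open>The two estimates feed each other: if \<open>\<bar>y\<bar>\<close> exceeded 1,
      they would give \<open>\<bar>y\<bar> \<le> \<bar>y\<bar> / 4 + 1 / 2\<close>.\<close>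
    have y1: "\<bar>y\<bar> \<le> 1" using 1 2 by (auto simp: max_def split: if_splits)
    with 2 have z1: "\<bar>z\<bar> \<le> 1 / 2" by auto
    have zR: "\<bar>z + 1\<bar> \<le> R" "\<bar>y + j\<bar> \<le> R" unfolding R_def using y1 z1 by linarith+
    have "(G ^^ n) 0 < (G ^^ n) (z + 1)" using z1 by (intro strict_monoD[OF Gn_mono]) linarith
    then have y0: "0 < y" by (simp add: Gn_0 y)
    have size: "exp (- 2 * W) * exp (- real n * \<Lambda>) * \<bar>z + 1\<bar> \<le> y"
        "y \<le> exp (2 * W) * exp (- real n * \<Lambda>) * \<bar>z + 1\<bar>"
        "\<bar>z\<bar> \<le> exp (2 * W) * exp (- real m * \<Lambda>) * \<bar>y + j\<bar>"
      using Gn_size[of R W "z + 1" n] Gn_size[of R W "y + j" m] W zR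
      unfolding y z abs_of_pos[OF y0] by blast+
    have "exp (- 2 * W) * exp (- real n * \<Lambda>) * (1 / 2) \<le> exp (- 2 * W) * exp (- real n * \<Lambda>) * \<bar>z + 1\<bar>"
      using z1 by (intro mult_left_mono) auto
    then have "exp (- 2 * W) / 2 * exp (- real n * \<Lambda>) \<le> y"
      using size(1) by linarith
    moreover have "exp (2 * W) * exp (- real n * \<Lambda>) * \<bar>z + 1\<bar> \<le> exp (2 * W) * exp (- real n * \<Lambda>) * R"
      "exp (2 * W) * exp (- real m * \<Lambda>) * \<bar>y + j\<bar> \<le> exp (2 * W) * exp (- real m * \<Lambda>) * R"
      using zR by (intro mult_left_mono; simp)+
    ultimately show ?thesis
      using size(2,3) by (auto simp: mult_ac intro: order_trans)
  qed
  have "exp (- 2 * W) / 2 > 0" "exp (2 * W) * R > 0" by (auto simp: R_def)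
  with main show ?thesis by blast
qed

text \<open>This keeps the length estimates on the line;
  \<open>spectrum_subset_length_spectrum\<close> relates it to the circle.\<close>

definition spectrum :: "real set" where
  "spectrum = {ln (deriv (F ^^ n) y) |n y. n \<ge> 1 \<and> (F ^^ n) y - y \<in> \<int>}"

text \<open>The orbit runs from \<open>y\<close> to \<open>z + 1\<close> in \<open>n\<close> steps;
  as \<open>deriv (F ^^ m)\<close> is 1-periodic, the next \<open>m\<close> steps count as a run
  from \<open>z\<close> to \<open>y + j\<close>. Each leg telescopes by \<open>Fn_der\<close>, so
  only the jumps of \<omega> under the integer translations \<open>1\<close> and \<open>j\<close>
  remain.\<close>

lemma crossing_orbit_length:
  assumes "n + m \<ge> 1" and y: "(G ^^ n) (z + 1) = y" and z: "(G ^^ m) (y + of_int j) = z"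
  shows "real (n + m) * \<Lambda> + (\<omega> (z + 1) - \<omega> z) + (\<omega> (y + of_int j) - \<omega> y) \<in> spectrum"
proof -
  have Fy: "(F ^^ n) y = z + 1" using Fn_Gn[of n "z + 1"] y by simp
  have Fz: "(F ^^ m) z = y + of_int j" using Fn_Gn[of m "y + of_int j"] z by simp
  have der: "((F ^^ k) has_real_derivative deriv (F ^^ k) x) (at x)" for k x
    using Fn_der[of k x] DERIV_imp_deriv by metis
  have "(F ^^ (m + n)) y = y + of_int (j + int d ^ m)"
    using Fn_int[of m z 1] by (simp add: funpow_add Fy Fz)
  then have per: "(F ^^ (m + n)) y - y \<in> \<int>" by simp
  have "deriv (F ^^ m) (z + 1) = deriv (F ^^ m) z"
    using Fn_int[of m _ 1] by (intro deriv_add_equivariant[of _ 1 "real d ^ m", OF der]) simp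
  also have "\<dots> = exp (real m * \<Lambda> + \<omega> (y + of_int j) - \<omega> z)"
    using Fn_der[of m z] DERIV_imp_deriv Fz by metis
  finally have "((F ^^ m) has_real_derivative exp (real m * \<Lambda> + \<omega> (y + of_int j) - \<omega> z)) (at ((F ^^ n) y))"
    using der[of m "z + 1"] Fy by simp
  from DERIV_chain[OF this Fn_der]
  have "((F ^^ (m + n)) has_real_derivative exp (real m * \<Lambda> + \<omega> (y + of_int j) - \<omega> z)
      * exp (real n * \<Lambda> + \<omega> (z + 1) - \<omega> y)) (at y)"
    by (simp add: funpow_add Fy)
  then have "ln (deriv (F ^^ (m + n)) y)
      = (real m * \<Lambda> + \<omega> (y + of_int j) - \<omega> z) + (real n * \<Lambda> + \<omega> (z + 1) - \<omega> y)"
    unfolding mult_exp_exp by (simp add: DERIV_imp_deriv)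
  also have "\<dots> = real (n + m) * \<Lambda> + (\<omega> (z + 1) - \<omega> z) + (\<omega> (y + of_int j) - \<omega> y)"
    by (simp add: algebra_simps)
  finally show ?thesis
    unfolding spectrum_def using per assms(1) by (intro CollectI exI[of _ "m + n"] exI[of _ y]) auto
qed

text \<open>The crossing orbits for \<open>(n, 3n)\<close> and \<open>(2n, 2n)\<close> have lengths \<open>l\<close> whose difference is of the
  order \<open>exp (-l / 4)\<close>, so \<open>\<beta> < 1 / 4 < \<gamma>\<close> would suffice.\<close>

lemma sparse_imp_deriv_\<omega>_int:
  assumes sparse: "sparse_spectrum \<beta> \<gamma> S" "spectrum \<subseteq> S" and \<beta>: "\<beta> > 0" "\<beta> \<le> 1 / 8" and \<gamma>: "\<gamma> \<ge> 1"
  shows "deriv \<omega> (of_int j) = deriv \<omega> 0"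
proof (rule ccontr)
  define a where "a = deriv \<omega> (of_int j) - deriv \<omega> 0"
  assume "deriv \<omega> (of_int j) \<noteq> deriv \<omega> 0"
  then have a: "\<bar>a\<bar> > 0" by (simp add: a_def)
  \<comment> \<open>A crossing orbit has length \<open>(n + m) * \<Lambda> + u 1 z + u j y\<close>,
    and \<open>a\<close> is the derivative of \<open>u j\<close> at \<open>0\<close>.\<close>
  define u where "u k x = \<omega> (x + of_int k) - \<omega> x" for k :: int and x
  have u_der: "(u k has_real_derivative deriv \<omega> (of_int k) - deriv \<omega> 0) (at 0)" for k
    unfolding u_def[abs_def]
    using DERIV_diff[OF DERIV_shift[THEN iffD1, of \<omega> _ 0 "of_int k"], OF _ \<omega>_der] \<omega>_der[of "of_int k"] by simp
  have approx: "\<exists>\<delta>>0. \<forall>x. \<bar>x\<bar> < \<delta> \<longrightarrow> \<bar>u k x - u k 0 - (deriv \<omega> (of_int k) - deriv \<omega> 0) * x\<bar> \<le> e * \<bar>x\<bar>"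
    if "e > 0" for k e
    using u_der[of k] that unfolding has_field_derivative_def has_derivative_at_alt by force
  obtain \<delta> where \<delta>: "\<delta> > 0" "\<And>x. \<bar>x\<bar> < \<delta> \<Longrightarrow> \<bar>u j x - u j 0 - a * x\<bar> \<le> \<bar>a\<bar> / 2 * \<bar>x\<bar>"
    using approx[of "\<bar>a\<bar> / 2" j] a unfolding a_def[symmetric] by auto
  \<comment> \<open>For \<open>u 1\<close> a Lipschitz bound at \<open>0\<close> is enough, since
    \<open>z\<^sub>1\<close> and \<open>z\<^sub>2\<close> will be of higher order than
    \<open>y\<^sub>1\<close>.\<close>
  define K where "K = \<bar>deriv \<omega> (of_int 1) - deriv \<omega> 0\<bar> + 1"
  obtain \<delta>\<^sub>1 where \<delta>\<^sub>1: "\<delta>\<^sub>1 > 0" "\<And>x. \<bar>x\<bar> < \<delta>\<^sub>1 \<Longrightarrow> \<bar>u 1 x - u 1 0\<bar> \<le> K * \<bar>x\<bar>"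
  proof -
    obtain \<delta>\<^sub>1 where \<delta>\<^sub>1: "\<delta>\<^sub>1 > 0" "\<And>x. \<bar>x\<bar> < \<delta>\<^sub>1 \<Longrightarrow>
        \<bar>u 1 x - u 1 0 - (deriv \<omega> (of_int 1) - deriv \<omega> 0) * x\<bar> \<le> 1 * \<bar>x\<bar>"
      using approx[of 1 1] by auto
    have "\<bar>u 1 x - u 1 0\<bar> \<le> K * \<bar>x\<bar>" if "\<bar>x\<bar> < \<delta>\<^sub>1" for x
    proof -
      have "\<bar>u 1 x - u 1 0\<bar> \<le> \<bar>(deriv \<omega> (of_int 1) - deriv \<omega> 0) * x\<bar> + 1 * \<bar>x\<bar>"
        using \<delta>\<^sub>1(2)[OF that] by linarith
      then show ?thesis by (simp add: K_def abs_mult distrib_right)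
    qed
    with \<delta>\<^sub>1(1) that show ?thesis by blast
  qed
  have K: "K > 0" by (simp add: K_def)
  obtain c C N where c: "c > 0" and C: "C > 0" and orbit: "\<And>n m y z. n \<ge> N \<Longrightarrow> m \<ge> N \<Longrightarrow>
      (G ^^ n) (z + 1) = y \<Longrightarrow> (G ^^ m) (y + of_int j) = z \<Longrightarrow>
      c * exp (- real n * \<Lambda>) \<le> y \<and> y \<le> C * exp (- real n * \<Lambda>) \<and> \<bar>z\<bar> \<le> C * exp (- real m * \<Lambda>)"
    using crossing_orbit_size[of "of_int j"] by metis
  obtain C\<^sub>\<beta> C\<^sub>\<gamma> where C\<^sub>\<beta>: "C\<^sub>\<beta> > 0" and C\<^sub>\<gamma>: "C\<^sub>\<gamma> > 0" and dichotomy: "\<And>l\<^sub>1 l\<^sub>2. l\<^sub>1 \<in> S \<Longrightarrow> l\<^sub>2 \<in> S \<Longrightarrow>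
        \<bar>l\<^sub>1 - l\<^sub>2\<bar> \<ge> C\<^sub>\<beta> * exp (- \<beta> * max l\<^sub>1 l\<^sub>2) \<or> \<bar>l\<^sub>1 - l\<^sub>2\<bar> \<le> C\<^sub>\<gamma> * exp (- \<gamma> * min l\<^sub>1 l\<^sub>2)"
    using sparse(1) unfolding sparse_spectrum_def by blast
  \<comment> \<open>\<open>V\<close> collects the errors of order \<open>t * t\<close>: one
    \<open>K * C\<close> for each of \<open>z\<^sub>1\<close> and \<open>z\<^sub>2\<close>, and the
    contribution of \<open>y\<^sub>2\<close>. The difference of the lengths will be at most
    \<open>U * t\<close>, and their distance from \<open>4 * n * \<Lambda>\<close> at most
    \<open>D\<close>.\<close>
  define V where "V = 2 * K * C + 2 * \<bar>a\<bar> * C"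
  define U where "U = 2 * \<bar>a\<bar> * C + V"
  define D where "D = \<bar>u 1 0\<bar> + \<bar>u j 0\<bar> + 1"
  have V: "V > 0" using K C a by (simp add: V_def add_pos_pos)

  \<comment> \<open>The square root of \<open>t = exp (- n * \<Lambda>)\<close>: a spare factor
    tending to \<open>0\<close> that absorbs all constants, and the order of
    \<open>exp (- l / 8)\<close> for lengths \<open>l\<close> near
    \<open>4 * n * \<Lambda>\<close>.\<close>
  define s where "s n = exp (- (\<Lambda> / 2)) ^ n" for n
  have s_exp: "s n = exp (- (real n * \<Lambda> / 2))" for n
    unfolding s_def exp_of_nat_mult[symmetric] by simp
  have "s \<longlonglongrightarrow> 0" unfolding s_def[abs_def] using \<Lambda>_pos by (intro LIMSEQ_power_zero) simp
  then have small: "\<forall>\<^sub>F n in sequentially. x * s n < e" if "e > 0" for x e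
    using order_tendstoD(2)[OF tendsto_mult_right_zero, of s _ e x] that by blast
  have ev: "\<forall>\<^sub>F n in sequentially. n \<ge> N \<and> n \<ge> 1 \<and> C * s n < \<delta> \<and> C * s n < \<delta>\<^sub>1 \<and> K * C * s n < 1 / 2
      \<and> 2 * \<bar>a\<bar> * C * s n < 1 / 2 \<and> V * s n < \<bar>a\<bar> * c / 4 \<and> U * s n < C\<^sub>\<beta> * exp (- D / 8)
      \<and> C\<^sub>\<gamma> * exp D * s n < \<bar>a\<bar> * c / 4 \<and> 1 * s n < exp (- D)"
    by (intro eventually_conj eventually_ge_at_top small) (use \<delta>(1) \<delta>\<^sub>1(1) a c C\<^sub>\<beta> in auto)
  obtain n where n: "n \<ge> N" "n \<ge> 1" "C * s n < \<delta>" "C * s n < \<delta>\<^sub>1" "K * C * s n < 1 / 2"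
    "2 * \<bar>a\<bar> * C * s n < 1 / 2" "V * s n < \<bar>a\<bar> * c / 4" "U * s n < C\<^sub>\<beta> * exp (- D / 8)"
    "C\<^sub>\<gamma> * exp D * s n < \<bar>a\<bar> * c / 4" "1 * s n < exp (- D)"
    using eventually_happens'[OF sequentially_bot ev] by blast
  define t where "t = s n * s n"
  have s: "0 < s n" "s n \<le> 1" using \<Lambda>_pos by (auto simp: s_exp)
  have "0 < t" "t \<le> s n"
    using s mult_left_le[of "s n" "s n"] by (simp_all add: t_def)
  moreover from this s have "t \<le> 1" by linarith
  ultimately have t: "0 < t" "t \<le> s n" "t \<le> 1" "t * t \<le> t" "t * t * t \<le> t * t"
    by (simp_all add: mult_left_le)
  have t_exp: "exp (- real n * \<Lambda>) = t" "exp (- real (2 * n) * \<Lambda>) = t * t" "exp (- real (3 * n) * \<Lambda>) = t * t * t"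
    unfolding t_def s_exp mult_exp_exp by (simp_all add: algebra_simps)
  have le: "C * x \<le> C * s n" if "x \<le> t" for x
    using that t C by (intro mult_left_mono) auto

  \<comment> \<open>Both orbits have period \<open>4 * n\<close>, so
    \<open>4 * n * \<Lambda>\<close>, \<open>u 1 0\<close> and \<open>u j 0\<close> cancel in the
    difference of the lengths. Here \<open>y\<^sub>1\<close> is of order \<open>t\<close>, while
    \<open>y\<^sub>2\<close>, \<open>z\<^sub>1\<close> and \<open>z\<^sub>2\<close> are at most of
    order \<open>t * t\<close>: only \<open>a * y\<^sub>1\<close> survives at first order.\<close>
  have n': "2 * n \<ge> N" "3 * n \<ge> N" using n(1) by auto
  obtain y\<^sub>1 z\<^sub>1 where o1: "(G ^^ n) (z\<^sub>1 + 1) = y\<^sub>1" "(G ^^ (3 * n)) (y\<^sub>1 + of_int j) = z\<^sub>1"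
    using crossing_orbit[OF trans_le_add1[OF n(2)], of "3 * n"] by blast
  obtain y\<^sub>2 z\<^sub>2 where o2: "(G ^^ (2 * n)) (z\<^sub>2 + 1) = y\<^sub>2" "(G ^^ (2 * n)) (y\<^sub>2 + of_int j) = z\<^sub>2"
  proof -
    have "2 * n + 2 * n \<ge> 1" using n(2) by simp
    from crossing_orbit[OF this] that show ?thesis by blast
  qed
  have y1: "c * t \<le> y\<^sub>1" "y\<^sub>1 \<le> C * t" and z1: "\<bar>z\<^sub>1\<bar> \<le> C * (t * t * t)"
    using orbit[OF n(1) n'(2) o1] unfolding t_exp by auto
  have y2: "c * (t * t) \<le> y\<^sub>2" "y\<^sub>2 \<le> C * (t * t)" and z2: "\<bar>z\<^sub>2\<bar> \<le> C * (t * t)"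
    using orbit[OF n'(1) n'(1) o2] unfolding t_exp by auto
  have y_pos: "0 < y\<^sub>1" "0 < y\<^sub>2" using y1(1) y2(1) c t(1) by (auto intro: less_le_trans[rotated])
  have z1': "\<bar>z\<^sub>1\<bar> \<le> C * (t * t)" using z1 mult_left_mono[OF t(5) less_imp_le[OF C]] by linarith
  define l\<^sub>1 where "l\<^sub>1 = 4 * real n * \<Lambda> + u 1 z\<^sub>1 + u j y\<^sub>1"
  define l\<^sub>2 where "l\<^sub>2 = 4 * real n * \<Lambda> + u 1 z\<^sub>2 + u j y\<^sub>2"
  have lS: "l\<^sub>1 \<in> S" "l\<^sub>2 \<in> S"
    using crossing_orbit_length[OF _ o1] crossing_orbit_length[OF _ o2] n(2) sparse(2)
    by (auto simp: l\<^sub>1_def l\<^sub>2_def u_def)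

  have Ez: "\<bar>u 1 z - u 1 0\<bar> \<le> K * C * (t * t)" if "\<bar>z\<bar> \<le> C * (t * t)" for z
  proof -
    have "\<bar>z\<bar> < \<delta>\<^sub>1" using that le[OF t(4)] n(4) by linarith
    then have "\<bar>u 1 z - u 1 0\<bar> \<le> K * \<bar>z\<bar>" by (rule \<delta>\<^sub>1)
    also have "\<dots> \<le> K * (C * (t * t))" using that K by (intro mult_left_mono) auto
    finally show ?thesis by (simp add: mult.assoc)
  qed
  have Ey: "\<bar>u j y - u j 0 - a * y\<bar> \<le> \<bar>a\<bar> / 2 * y" if "0 < y" "y \<le> C * x" "x \<le> t" for y x
    using \<delta>(2)[of y] that le[OF that(3)] n(3) by simp
  have Ey': "\<bar>u j y - u j 0\<bar> \<le> 2 * \<bar>a\<bar> * C * x" if "0 < y" "y \<le> C * x" "x \<le> t" for y x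
  proof -
    have "\<bar>a * y\<bar> = \<bar>a\<bar> * y" using that(1) by (simp add: abs_mult)
    then have "\<bar>u j y - u j 0\<bar> \<le> 2 * \<bar>a\<bar> * y"
      using Ey[OF that] mult_pos_pos[OF a that(1)] by linarith
    also have "\<dots> \<le> 2 * \<bar>a\<bar> * (C * x)" using that by (intro mult_left_mono) auto
    finally show ?thesis by (simp add: mult.assoc)
  qed
  have ay: "\<bar>a * y\<^sub>1\<bar> = \<bar>a\<bar> * y\<^sub>1" using y_pos by (simp add: abs_mult)
  have lower_y: "\<bar>a\<bar> * (c * t) \<le> \<bar>a\<bar> * y\<^sub>1" "\<bar>a\<bar> * y\<^sub>1 \<le> \<bar>a\<bar> * (C * t)"
    using y1 by (auto intro!: mult_left_mono)
  have Vtt: "V * (t * t) = 2 * (K * C * (t * t)) + 2 * \<bar>a\<bar> * C * (t * t)"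
    by (simp add: V_def algebra_simps)
  have diff: "\<bar>l\<^sub>1 - l\<^sub>2 - a * y\<^sub>1\<bar> \<le> \<bar>a\<bar> / 2 * y\<^sub>1 + V * (t * t)"
    unfolding Vtt using Ez[OF z1'] Ez[OF z2] Ey[OF y_pos(1) y1(2) order_refl] Ey'[OF y_pos(2) y2(2) t(4)]
    unfolding l\<^sub>1_def l\<^sub>2_def by linarith
  have "V * t \<le> V * s n" using V t by (intro mult_left_mono) auto
  then have "V * t \<le> \<bar>a\<bar> * c / 4" using n(7) by linarith
  then have Vt: "V * t * t \<le> \<bar>a\<bar> * c / 4 * t" using t by (intro mult_right_mono) auto
  \<comment> \<open>Half of \<open>\<bar>a\<bar> * c * t\<close> remains after the linearization
    error of \<open>u j\<close>, and the second order terms take at most half of that.\<close>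
  have lower: "\<bar>a\<bar> * c / 4 * t \<le> \<bar>l\<^sub>1 - l\<^sub>2\<bar>"
  proof -
    have "\<bar>a\<bar> * y\<^sub>1 \<le> \<bar>l\<^sub>1 - l\<^sub>2\<bar> + \<bar>l\<^sub>1 - l\<^sub>2 - a * y\<^sub>1\<bar>" unfolding ay[symmetric] by linarith
    then have "\<bar>a\<bar> * y\<^sub>1 / 2 \<le> \<bar>l\<^sub>1 - l\<^sub>2\<bar> + V * (t * t)" using diff by (simp add: mult.commute)
    moreover have "V * (t * t) \<le> \<bar>a\<bar> * (c * t) / 4" using Vt by (simp add: mult.assoc)
    moreover have "\<bar>a\<bar> * c / 4 * t = \<bar>a\<bar> * (c * t) / 4" by simp
    ultimately show ?thesis using lower_y(1) by argo
  qed
  have "V * (t * t) \<le> V * t" using V t by (intro mult_left_mono) auto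
  moreover have "\<bar>a\<bar> / 2 * y\<^sub>1 \<le> \<bar>a\<bar> * (C * t) / 2" using lower_y by simp
  moreover have "U * t = 2 * (\<bar>a\<bar> * (C * t)) + V * t" by (simp add: U_def algebra_simps)
  moreover have "0 \<le> \<bar>a\<bar> * (C * t)" using C t by simp
  ultimately have upper: "\<bar>l\<^sub>1 - l\<^sub>2\<bar> \<le> U * t"
    using diff ay lower_y by linarith

  have KC: "K * C * (t * t) \<le> 1 / 2" "2 * \<bar>a\<bar> * C * x \<le> 1 / 2" if "x \<le> t" for x
  proof -
    have "K * C * (t * t) \<le> K * C * s n" using K C t by (intro mult_left_mono order_trans[OF t(4,2)]) auto
    then show "K * C * (t * t) \<le> 1 / 2" using n(5) by linarith
    have "2 * \<bar>a\<bar> * C * x \<le> 2 * \<bar>a\<bar> * C * s n" using C t that by (intro mult_left_mono) auto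
    then show "2 * \<bar>a\<bar> * C * x \<le> 1 / 2" using n(6) by linarith
  qed
  have l1: "\<bar>l\<^sub>1 - 4 * real n * \<Lambda>\<bar> \<le> D"
    using Ez[OF z1'] Ey'[OF y_pos(1) y1(2) order_refl] KC[OF order_refl]
    unfolding l\<^sub>1_def D_def by linarith
  have l2: "\<bar>l\<^sub>2 - 4 * real n * \<Lambda>\<bar> \<le> D"
    using Ez[OF z2] Ey'[OF y_pos(2) y2(2) t(4)] KC(1)[OF order_refl] KC(2)[OF t(4)]
    unfolding l\<^sub>2_def D_def by linarith
  have D0: "D \<ge> 0" by (simp add: D_def)
  have "- (real n * \<Lambda> / 2) < - D" using n(10) unfolding s_exp by simp
  then have nD: "4 * real n * \<Lambda> \<ge> D" using D0 by simp
  show False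
    using dichotomy[OF lS]
  proof
    \<comment> \<open>Separated lengths: with \<open>\<beta> \<le> 1 / 8\<close> the gap is at least
      of order \<open>s n\<close>, whereas the difference is at most \<open>U * t\<close>, of order
      \<open>s n * s n\<close>.\<close>
    assume *: "C\<^sub>\<beta> * exp (- \<beta> * max l\<^sub>1 l\<^sub>2) \<le> \<bar>l\<^sub>1 - l\<^sub>2\<bar>"
    have "max l\<^sub>1 l\<^sub>2 \<le> 4 * real n * \<Lambda> + D" using l1 l2 by auto
    then have "\<beta> * max l\<^sub>1 l\<^sub>2 \<le> \<beta> * (4 * real n * \<Lambda> + D)" using \<beta> by (intro mult_left_mono) auto
    also have "\<dots> \<le> 1 / 8 * (4 * real n * \<Lambda> + D)" using \<beta> nD D0 by (intro mult_right_mono) auto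
    finally have "- D / 8 + - (real n * \<Lambda> / 2) \<le> - \<beta> * max l\<^sub>1 l\<^sub>2" by simp
    then have "exp (- D / 8) * s n \<le> exp (- \<beta> * max l\<^sub>1 l\<^sub>2)"
      unfolding s_exp mult_exp_exp by simp
    then have "C\<^sub>\<beta> * (exp (- D / 8) * s n) \<le> C\<^sub>\<beta> * exp (- \<beta> * max l\<^sub>1 l\<^sub>2)"
      using C\<^sub>\<beta> by (intro mult_left_mono) auto
    then have "(C\<^sub>\<beta> * exp (- D / 8)) * s n \<le> (U * s n) * s n"
      using * upper unfolding t_def by (simp add: mult.assoc)
    then show False using n(8) s(1) by (simp only: mult_le_cancel_right_pos)
  next
    \<comment> \<open>Nearly equal lengths: with \<open>\<gamma> \<ge> 1\<close> they differ by at
      most a multiple of \<open>t ^ 4\<close>, against a lower bound of order \<open>t\<close>. By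
      \<open>nD\<close> the smaller length is nonnegative, so \<gamma> may be replaced by
      \<open>1\<close>.\<close>
    assume *: "\<bar>l\<^sub>1 - l\<^sub>2\<bar> \<le> C\<^sub>\<gamma> * exp (- \<gamma> * min l\<^sub>1 l\<^sub>2)"
    have min: "min l\<^sub>1 l\<^sub>2 \<ge> 4 * real n * \<Lambda> - D" using l1 l2 by auto
    then have "1 * min l\<^sub>1 l\<^sub>2 \<le> \<gamma> * min l\<^sub>1 l\<^sub>2" using \<gamma> nD by (intro mult_right_mono) linarith+
    moreover have "D + (- real (2 * n) * \<Lambda> + - real (2 * n) * \<Lambda>) = - (4 * real n * \<Lambda> - D)" by simp
    ultimately have "- \<gamma> * min l\<^sub>1 l\<^sub>2 \<le> D + (- real (2 * n) * \<Lambda> + - real (2 * n) * \<Lambda>)"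
      unfolding mult_minus_left using min by linarith
    then have "exp (- \<gamma> * min l\<^sub>1 l\<^sub>2) \<le> exp D * (t * t * (t * t))"
      unfolding t_exp(2)[symmetric] mult_exp_exp by simp
    also have "\<dots> \<le> exp D * (s n * t)"
    proof -
      have "t * t * (t * t) \<le> t * t * 1" using t by (intro mult_left_mono order_trans[OF t(4,3)]) auto
      also have "\<dots> \<le> s n * t" using t by (simp add: mult_right_mono)
      finally show ?thesis by simp
    qed
    finally have "C\<^sub>\<gamma> * exp (- \<gamma> * min l\<^sub>1 l\<^sub>2) \<le> C\<^sub>\<gamma> * (exp D * (s n * t))"
      using C\<^sub>\<gamma> by (intro mult_left_mono) auto
    then have "(\<bar>a\<bar> * c / 4) * t \<le> (C\<^sub>\<gamma> * exp D * s n) * t"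
      using * lower by (simp add: mult.assoc)
    then show False using n(9) t(1) by (simp only: mult_le_cancel_right_pos)
  qed
qed

end

section \<open>Linearization\<close>

context expanding_lift
begin

lemma deriv_\<omega>_G: "deriv \<omega> x = deriv G x * deriv \<omega> (G x) + deriv G x * deriv \<psi> (G x)"
proof -
  have "((\<lambda>x. \<psi> (G x) - \<Lambda> + \<omega> (G x)) has_real_derivative
      (deriv \<psi> (G x) * deriv G x - 0) + deriv \<omega> (G x) * deriv G x) (at x)"
    by (intro DERIV_add DERIV_diff DERIV_const DERIV_chain2[OF \<psi>_der G_der'] DERIV_chain2[OF \<omega>_der G_der'])
  then have "(\<omega> has_real_derivative
      (deriv \<psi> (G x) * deriv G x - 0) + deriv \<omega> (G x) * deriv G x) (at x)"
    unfolding \<omega>_G[symmetric] .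
  from DERIV_imp_deriv[OF this] show ?thesis by (simp add: mult.commute)
qed

text \<open>Since \<open>deriv \<psi>\<close> is 1-periodic and the shift by \<open>k * d\<close>
  does not change \<open>deriv G\<close>, \<open>deriv_\<omega>_G\<close> turns the difference of
  the left-hand sides into that at \<open>G x\<close> times \<open>deriv G x\<close>, which is
  nonzero.\<close>

lemma deriv_\<omega>_shift_G:
  "deriv \<omega> (x + of_int (k * int d)) = deriv \<omega> x \<longleftrightarrow> deriv \<omega> (G x + of_int k) = deriv \<omega> (G x)"
proof -
  have "deriv \<psi> (y + 1) = deriv \<psi> y" for y
    by (rule deriv_add_equivariant[of _ 1 0, OF \<psi>_der]) (simp add: \<psi>_shift)
  then have \<psi>: "deriv \<psi> (G x + of_int k) = deriv \<psi> (G x)" by (rule periodic_of_int)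
  have "deriv G (x + of_int (k * int d)) = deriv G x"
    by (rule deriv_add_equivariant[OF G_der' G_int])
  then show ?thesis
    unfolding deriv_\<omega>_G[of x] deriv_\<omega>_G[of "x + of_int (k * int d)"] G_int \<psi>
    using deriv_G_pos[of x] by simp
qed

lemma deriv_\<omega>_shift_Gn:
  "deriv \<omega> (x + of_int (k * int d ^ n)) = deriv \<omega> x \<longleftrightarrow>
    deriv \<omega> ((G ^^ n) x + of_int k) = deriv \<omega> ((G ^^ n) x)"
proof (induction n arbitrary: x)
  case (Suc n)
  have "k * int d ^ Suc n = (k * int d ^ n) * int d" by simp
  then show ?case using deriv_\<omega>_shift_G[of x "k * int d ^ n"] Suc[of "G x"]
    by (simp add: funpow_swap1 mult_ac)
qed simp

text \<open>The preimages under \<open>F\<^sup>n\<close> of the integers become dense, and the previous equivalence turns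
  the hypothesis on integers into periodicity at all of them.\<close>

lemma deriv_\<omega>_periodic:
  assumes "\<And>j. deriv \<omega> (of_int j) = deriv \<omega> 0"
  shows "deriv \<omega> (x + 1) = deriv \<omega> x"
proof -
  \<comment> \<open>The preimage under \<open>F ^^ n\<close> of the integer part of
    \<open>(F ^^ n) x\<close>; contraction puts it within \<open>\<kappa> ^ n\<close> of
    \<open>x\<close>.\<close>
  define p where "p n = (G ^^ n) (of_int \<lfloor>(F ^^ n) x\<rfloor>)" for n
  have "deriv \<omega> (p n + of_int 1) = deriv \<omega> (p n)" for n
    unfolding p_def deriv_\<omega>_shift_Gn[symmetric] using assms by (metis of_int_add)
  then have eq: "deriv \<omega> (p n + 1) = deriv \<omega> (p n)" for n by simp
  have "norm (p n - x) \<le> \<kappa> ^ n" for n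
  proof -
    have "\<bar>p n - x\<bar> \<le> \<kappa> ^ n * \<bar>of_int \<lfloor>(F ^^ n) x\<rfloor> - (F ^^ n) x\<bar>"
      using Gn_Lipschitz[of n "of_int \<lfloor>(F ^^ n) x\<rfloor>" "(F ^^ n) x"] by (simp add: p_def Gn_Fn)
    also have "\<dots> \<le> \<kappa> ^ n * 1" using \<kappa> by (intro mult_left_mono) (auto, linarith)
    finally show ?thesis by simp
  qed
  moreover have "(\<lambda>n. \<kappa> ^ n) \<longlonglongrightarrow> 0" using \<kappa> by (intro LIMSEQ_power_zero) auto
  ultimately have "(\<lambda>n. p n - x) \<longlonglongrightarrow> 0"
    by (intro Lim_null_comparison[of "\<lambda>n. p n - x" "\<lambda>n. \<kappa> ^ n"] always_eventually allI)
  then have p: "p \<longlonglongrightarrow> x" by (simp add: LIM_zero_iff)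
  have cont: "isCont (deriv \<omega>) y" for y
    using \<omega>_C1 unfolding cont_diff_Suc_deriv by (simp add: continuous_on_eq_continuous_at)
  have "(\<lambda>n. deriv \<omega> (p n + 1)) \<longlonglongrightarrow> deriv \<omega> (x + 1)"
    by (intro isCont_tendsto_compose[OF cont] tendsto_add p tendsto_const)
  moreover have "(\<lambda>n. deriv \<omega> (p n)) \<longlonglongrightarrow> deriv \<omega> x"
    by (intro isCont_tendsto_compose[OF cont] p)
  ultimately show ?thesis unfolding eq by (rule LIMSEQ_unique)
qed

text \<open>A periodic derivative leaves only a constant increment \<open>\<omega> 1\<close> per
  period. A shift by 1 before applying \<open>F\<close> is a shift by \<open>d\<close> after it, so
  the functional equation gives \<open>\<omega> 1 = d * \<omega> 1\<close>.\<close>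

lemma \<omega>_periodic:
  assumes "\<And>j. deriv \<omega> (of_int j) = deriv \<omega> 0"
  shows "\<omega> (x + 1) = \<omega> x"
proof -
  have shift: "\<omega> (x + 1) = \<omega> x + \<omega> 1" for x
    using shift_of_periodic_derivative[OF \<omega>_der deriv_\<omega>_periodic[OF assms]] by (simp add: \<omega>_0)
  have F: "\<omega> (F y) = \<psi> y - \<Lambda> + \<omega> y" for y
    using \<omega>_G[of "F y"] by (simp add: GF) 
  have "\<omega> (F 0 + real d) = \<omega> (F 0) + \<omega> 1"
    using F[of "0 + 1"] F[of 0] unfolding F_shift shift[of 0] \<psi>_shift by simp
  moreover have "\<omega> (F 0 + real d) = \<omega> (F 0) + real d * \<omega> 1"
    using add_of_int_equivariant[of \<omega> "\<omega> 1" "F 0" "int d", OF shift] by simp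
  ultimately have "\<omega> 1 = real d * \<omega> 1" by simp
  then have "\<omega> 1 = 0" using d by simp
  then show ?thesis using shift by simp
qed

text \<open>\<Phi> is the primitive of \<open>exp (- \<omega>)\<close>, normalized to increase by 1
  over a period. By \<open>F'_\<omega>\<close>, \<open>P \<circ> F\<close> and
  \<open>exp \<Lambda> * P\<close> have the same derivative; comparing their values at
  \<open>1\<close>, where \<open>F 1 = d\<close>, gives \<open>exp \<Lambda> = d\<close>.\<close>

lemma smooth_linearization:
  assumes "\<And>x. \<omega> (x + 1) = \<omega> x"
  shows "\<exists>\<Phi>. \<Phi> 0 = 0 \<and> (\<forall>x. \<Phi> (x + 1) = \<Phi> x + 1) \<and> (\<forall>x. \<Phi> (F x) = real d * \<Phi> x) \<and>
    (\<forall>x. deriv \<Phi> x > 0) \<and> (\<forall>k\<ge>2. cont_diff k F \<longrightarrow> cont_diff k \<Phi>)"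
proof -
  let ?u = "\<lambda>x. exp (- 1 * \<omega> x)"
  have "isCont ?u x" for x
    using DERIV_isCont[OF \<omega>_der] by (intro continuous_intros)
  then obtain P\<^sub>0 where "\<And>x. (P\<^sub>0 has_vector_derivative ?u x) (at x)"
    using einterval_antiderivative[of "-\<infinity>" "\<infinity>" ?u] by auto
  then have P\<^sub>0: "(P\<^sub>0 has_real_derivative ?u x) (at x)" for x
    by (simp add: has_real_derivative_iff_has_vector_derivative)
  define P where "P x = P\<^sub>0 x - P\<^sub>0 0" for x
  have P0: "P 0 = 0" by (simp add: P_def)
  have P: "(P has_real_derivative ?u x) (at x)" for x
    unfolding P_def[abs_def] using DERIV_diff[OF P\<^sub>0 DERIV_const] by simp
  have "P 0 < P 1" using DERIV_pos_imp_increasing[of 0 1 P] P exp_gt_zero zero_less_one by blast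
  then have P1: "P 1 > 0" by (simp add: P0)
  have shift: "P (x + 1) = P x + P 1" for x
    using shift_of_periodic_derivative[OF P, of x] by (simp add: P0 assms)
  have "((\<lambda>x. P (F x) - exp \<Lambda> * P x) has_real_derivative ?u (F x) * deriv F x - exp \<Lambda> * ?u x) (at x)" for x
    by (intro DERIV_diff DERIV_cmult P DERIV_chain2[OF P F_der])
  moreover have "?u (F x) * deriv F x - exp \<Lambda> * ?u x = 0" for x
    unfolding F'_\<omega> mult_exp_exp by simp
  ultimately have "((\<lambda>x. P (F x) - exp \<Lambda> * P x) has_real_derivative 0) (at x)" for x by simp
  then have "P (F x) - exp \<Lambda> * P x = P (F 0) - exp \<Lambda> * P 0" for x
    by (rule DERIV_isconst_all[rule_format, of "\<lambda>x. P (F x) - exp \<Lambda> * P x"])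
  then have PF: "P (F x) = exp \<Lambda> * P x" for x by (simp add: F0 P0)
  have "P (F 1) = real d * P 1"
    using add_of_int_equivariant[of P "P 1" 0 "int d", OF shift] F_int[of 0 1] by (simp add: P0 F0)
  then have \<Lambda>: "exp \<Lambda> = real d" using PF[of 1] P1 by simp
  define \<Phi> where "\<Phi> x = (1 / P 1) * P x" for x
  have \<Phi>: "(\<Phi> has_real_derivative (1 / P 1) * ?u x) (at x)" for x
    unfolding \<Phi>_def[abs_def] by (intro DERIV_cmult P)
  \<comment> \<open>No derivative is lost: \<open>F\<close> of class \<open>m + 2\<close> makes
    \<open>deriv \<psi>\<close> of class \<open>m\<close>, the functional equation passes this on to
    \<open>deriv \<omega>\<close>, and integrating twice returns to class
    \<open>m + 2\<close>.\<close>
  have C: "cont_diff (Suc (Suc m)) \<Phi>" if F: "cont_diff (Suc (Suc m)) F" for m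
  proof -
    have G: "cont_diff (Suc m) G" "cont_diff (Suc m) (deriv G)"
      using cont_diff_SucD[OF G_C[OF F]] G_C[OF F] cont_diff_Suc_deriv[of "Suc m" G] by blast+
    have \<psi>: "cont_diff m (deriv \<psi>)" using \<psi>_C[OF F] unfolding cont_diff_Suc_deriv[of m] by blast
    have abs: "\<bar>deriv G x\<bar> \<le> \<kappa>" for x using \<kappa>(3)[of x] deriv_G_pos[of x] by simp
    have "cont_diff m (deriv \<omega>)"
    proof (rule cont_diff_functional_equation[where a = "deriv G" and G = G and \<kappa> = \<kappa>
          and q = "\<lambda>x. deriv G x * deriv \<psi> (G x)"])
      show "cont_diff m G" "cont_diff m (deriv G)" using G cont_diff_SucD by blast+
      then show "cont_diff m (\<lambda>x. deriv G x * deriv \<psi> (G x))"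
        by (intro cont_diff_mult cont_diff_compose[OF \<psi>])
      show "continuous_on UNIV (deriv \<omega>)" using \<omega>_C1 unfolding cont_diff_Suc_deriv by simp
      show "\<bar>G x\<bar> \<le> \<bar>x\<bar>" for x using Gn_abs_le'[of 1 x] by simp
      show "\<bar>deriv G x\<bar> \<le> 1" for x using abs[of x] \<kappa>(2) by linarith
    qed (rule abs \<kappa>(2) deriv_\<omega>_G)+
    then have "cont_diff (Suc m) \<omega>" using \<omega>_der unfolding cont_diff_Suc_deriv[of m] by blast
    then have "cont_diff (Suc m) (\<lambda>x. (1 / P 1) * ?u x)"
      by (intro cont_diff_mult cont_diff_const cont_diff_compose[OF cont_diff_exp])
    then show ?thesis by (rule cont_diff_SucI[OF \<Phi>])
  qed
  have "cont_diff k \<Phi>" if k: "k \<ge> 2" "cont_diff k F" for k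
  proof -
    obtain m where "k = Suc (Suc m)" using le_Suc_ex[OF k(1)] by auto
    then show ?thesis using C k(2) by simp
  qed
  moreover have "deriv \<Phi> x > 0" for x
    using DERIV_imp_deriv[OF \<Phi>] P1 by simp
  ultimately show ?thesis
    using P0 P1 shift PF \<Lambda> by (intro exI[of _ \<Phi>]) (auto simp: \<Phi>_def add_divide_distrib)
qed

end

section \<open>Descending to the circle\<close>

lemma to_circle_eq_iff: "to_circle x = to_circle y \<longleftrightarrow> x - y \<in> \<int>"
  by (rule circle.abs_eq_iff)

lemma to_circle_rep: "to_circle (rep_circle p) = p"
  by (rule Quotient_abs_rep[OF Quotient_circle])

lemma rep_to_circle: "\<exists>k. x = rep_circle (to_circle x) + of_int k"
proof -
  have "x - rep_circle (to_circle x) \<in> \<int>"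
    unfolding to_circle_eq_iff[symmetric] by (simp add: to_circle_rep)
  then show ?thesis by (metis Ints_cases add.commute diff_add_cancel)
qed

lemma is_lift_continuous: "is_lift F f \<Longrightarrow> continuous_on UNIV f"
  unfolding continuous_on_open_vimage[OF open_UNIV]
proof (intro allI impI)
  fix B :: "circle set"
  assume F: "is_lift F f" and "open B"
  then have "open (F -` (to_circle -` B))"
    using open_vimage[of "to_circle -` B" F] unfolding is_lift_def open_circle_def by blast
  moreover have "to_circle -` (f -` B) = F -` (to_circle -` B)"
    using F unfolding is_lift_def by auto
  ultimately show "open (f -` B \<inter> UNIV)" unfolding open_circle_def by simp
qed

text \<open>The difference of two lifts is continuous and integer-valued, hence constant.\<close>

lemma is_lift_unique_plus_int:
  assumes "is_lift F f" "is_lift F' f"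
  shows "\<exists>k. \<forall>x. F x = F' x + of_int k"
proof -
  have int: "F x - F' x \<in> \<int>" for x
    using assms unfolding is_lift_def to_circle_eq_iff[symmetric] by simp
  have "(\<lambda>x. F x - F' x) constant_on UNIV"
  proof (rule continuous_discrete_range_constant)
    show "continuous_on UNIV (\<lambda>x. F x - F' x)"
      using assms unfolding is_lift_def by (intro continuous_intros) auto
    fix x :: real
    have "1 \<le> norm ((F y - F' y) - (F x - F' x))" if "F y - F' y \<noteq> F x - F' x" for y
    proof -
      have "(F y - F' y) - (F x - F' x) \<in> \<int>" by (rule Ints_diff[OF int int])
      then show ?thesis using that Ints_nonzero_abs_ge1 by fastforce
    qed
    then show "\<exists>e>0. \<forall>y. y \<in> UNIV \<and> F y - F' y \<noteq> F x - F' x \<longrightarrow>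
        e \<le> norm (F y - F' y - (F x - F' x))"
      by (intro exI[of _ 1]) auto
  qed simp
  then obtain c where c: "\<And>x. F x - F' x = c" unfolding constant_on_def by auto
  then obtain k where "c = of_int k" using int[of 0] by (auto elim: Ints_cases)
  with c show ?thesis by (intro exI[of _ k]) (auto simp: algebra_simps)
qed

lemma is_lift_unique:
  assumes "is_lift F f" "is_lift F' f" "F 0 = F' 0"
  shows "F = F'"
  using is_lift_unique_plus_int[OF assms(1,2)] assms(3) by auto

lemma lift0_eq: "is_lift F f \<Longrightarrow> F 0 = 0 \<Longrightarrow> lift0 f = F"
  unfolding lift0_def by (rule the_equality) (auto intro: is_lift_unique)

lemma is_lift_funpow: "is_lift F f \<Longrightarrow> is_lift (F ^^ n) (f ^^ n)"
proof (induction n)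
  case (Suc n)
  then have "continuous_on UNIV (\<lambda>x. F ((F ^^ n) x))"
    unfolding is_lift_def by (intro continuous_on_compose2[of UNIV F UNIV "F ^^ n"]) auto
  with Suc show ?case unfolding is_lift_def by (auto simp: o_def)
qed (simp add: is_lift_def id_def)

lemma is_lift_minus_int: "is_lift F f \<Longrightarrow> c \<in> \<int> \<Longrightarrow> is_lift (\<lambda>x. F x - c) f"
proof -
  assume F: "is_lift F f" and c: "c \<in> \<int>"
  have "to_circle (F x - c) = to_circle (F x)" for x
    unfolding to_circle_eq_iff using c by simp
  with F show ?thesis unfolding is_lift_def by (auto intro: continuous_intros)
qed

lemma is_lift_0_Ints: "is_lift F f \<Longrightarrow> f 0 = 0 \<Longrightarrow> F 0 \<in> \<int>"
  using to_circle_eq_iff[of "F 0" 0] by (simp add: is_lift_def zero_circle_def)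

text \<open>The definitions supply one lift that is smooth and one that grows by \<open>d\<close>.
  They differ by an integer, so the smooth one, normalized to vanish at \<open>0\<close>, has both
  properties; it is the lift from which \<open>circle_deriv\<close> is computed.\<close>

lemma expanding_maps_lift:
  assumes f: "f \<in> expanding_maps d r" and d: "d \<ge> 2" and r: "r \<ge> 2"
  shows "\<exists>F. is_lift F f \<and> expanding_lift F d \<and> cont_diff r F"
proof -
  have f0: "f 0 = 0" and deriv: "\<And>p. circle_deriv f p > 1"
    using f by (auto simp: expanding_maps_def)
  obtain F\<^sub>1 where F1: "is_lift F\<^sub>1 f" "cont_diff r F\<^sub>1"
    using f C_k1_imp_cont_diff unfolding expanding_maps_def circle_C_k1_def by blast
  obtain F\<^sub>2 where F2: "is_lift F\<^sub>2 f" "\<And>x. F\<^sub>2 (x + 1) = F\<^sub>2 x + real d"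
    using f unfolding expanding_maps_def has_degree_def by blast
  obtain k where k: "\<And>x. F\<^sub>1 x = F\<^sub>2 x + of_int k"
    using is_lift_unique_plus_int[OF F1(1) F2(1)] by blast
  define F where "F x = F\<^sub>1 x + (- F\<^sub>1 0)" for x
  have lift: "is_lift F f"
    using is_lift_minus_int[OF F1(1) is_lift_0_Ints[OF F1(1) f0]] unfolding F_def[abs_def] by simp
  have C: "cont_diff r F"
    unfolding F_def[abs_def] by (intro cont_diff_add F1 cont_diff_const)
  have F0: "F 0 = 0" by (simp add: F_def)
  have shift: "F (x + 1) = F x + real d" for x by (simp add: F_def k F2)
  have "cont_diff (Suc 0) F" by (rule cont_diff_mono[OF C]) (use r in simp)
  then have der: "(F has_real_derivative deriv F x) (at x)" for x
    unfolding cont_diff_Suc_deriv by blast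
  have "deriv F (x + 1) = deriv F x" for x by (rule deriv_add_equivariant[OF der shift])
  note per = periodic_of_int[of "deriv F", OF this]
  have "deriv F x > 1" for x
  proof -
    obtain k where "x = rep_circle (to_circle x) + of_int k" using rep_to_circle by blast
    then have "deriv F x = circle_deriv f (to_circle x)"
      unfolding circle_deriv_def lift0_eq[OF lift F0] using per by metis
    then show ?thesis using deriv by simp
  qed
  moreover have "cont_diff 2 F" by (rule cont_diff_mono[OF C r])
  ultimately have "expanding_lift F d" using d F0 shift by unfold_locales
  with lift C show ?thesis by blast
qed

text \<open>\<open>deriv (F ^^ n)\<close> is 1-periodic, so the representative chosen by
  \<open>rep_circle\<close> gives the same derivative as \<open>y\<close>. Sparseness of the length
  spectrum thus applies to lengths computed on the line.\<close>

lemma (in expanding_lift) spectrum_subset_length_spectrum: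
  assumes lift: "is_lift F f"
  shows "spectrum \<subseteq> length_spectrum f"
proof
  fix l
  assume "l \<in> spectrum"
  then obtain n y where l: "l = ln (deriv (F ^^ n) y)" and n: "n \<ge> 1" and y: "(F ^^ n) y - y \<in> \<int>"
    unfolding spectrum_def by blast
  have Fn: "is_lift (F ^^ n) (f ^^ n)" by (rule is_lift_funpow[OF lift])
  have Fn0: "(F ^^ n) 0 = 0" by (induction n) (auto simp: F0)
  have "(F ^^ n) (x + 1) = (F ^^ n) x + real d ^ n" for x
    using Fn_int[of n x 1] by simp
  moreover have "((F ^^ n) has_real_derivative deriv (F ^^ n) x) (at x)" for x
    using Fn_der[of n x] DERIV_imp_deriv by metis
  ultimately have "deriv (F ^^ n) (x + 1) = deriv (F ^^ n) x" for x
    by (intro deriv_add_equivariant[of "F ^^ n" 1 "real d ^ n"])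
  note per = periodic_of_int[of "deriv (F ^^ n)", OF this]
  obtain k where "y = rep_circle (to_circle y) + of_int k" using rep_to_circle by blast
  then have "l = log_multiplier f n (to_circle y)"
    unfolding l log_multiplier_def circle_deriv_def lift0_eq[OF Fn Fn0] using per by metis
  moreover have "(f ^^ n) (to_circle y) = to_circle y"
    using Fn y unfolding is_lift_def to_circle_eq_iff[symmetric] by metis
  ultimately show "l \<in> length_spectrum f"
    unfolding length_spectrum_def length_spectrum_at_def periodic_points_def using n by auto
qed

section \<open>Linearizations and uniqueness of the marking conjugacy\<close>

text \<open>For \<open>k \<ge> 1\<close>, \<Phi> is the lift of an orientation-preserving
  diffeomorphism of the circle that conjugates the map lifted by \<open>F\<close> to multiplication
  by \<open>d\<close>.\<close>

definition linearizes :: "nat \<Rightarrow> nat \<Rightarrow> (real \<Rightarrow> real) \<Rightarrow> (real \<Rightarrow> real) \<Rightarrow> bool" where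
  "linearizes d k \<Phi> F \<longleftrightarrow> \<Phi> 0 = 0 \<and> (\<forall>x. \<Phi> (x + 1) = \<Phi> x + 1) \<and> (\<forall>x. \<Phi> (F x) = real d * \<Phi> x) \<and>
     (\<forall>x. deriv \<Phi> x > 0) \<and> cont_diff k \<Phi>"

lemma sparse_imp_linearizes:
  assumes f: "f \<in> expanding_maps d r" and d: "d \<ge> 2" and r: "r \<ge> 2"
    and sparse: "sparse_spectrum \<beta> \<gamma> (length_spectrum f)" and \<beta>: "0 < \<beta>" "\<beta> \<le> 1 / 8" and \<gamma>: "\<gamma> \<ge> 1"
  shows "\<exists>F \<Phi>. is_lift F f \<and> F 0 = 0 \<and> linearizes d r \<Phi> F"
proof -
  obtain F where F: "is_lift F f" "expanding_lift F d" "cont_diff r F"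
    using expanding_maps_lift[OF f d r] by blast
  interpret expanding_lift F d by (rule F)
  have "\<omega> (x + 1) = \<omega> x" for x
    by (intro \<omega>_periodic sparse_imp_deriv_\<omega>_int[OF sparse spectrum_subset_length_spectrum[OF F(1)] \<beta> \<gamma>])
  from smooth_linearization[OF this] show ?thesis
    unfolding linearizes_def using F(1,3) F0 r by blast
qed

text \<open>Being monotone and fixing the integers, \<tau> stays within distance 1 of the identity,
  while passing from \<open>x\<close> to \<open>d ^ n * x\<close> magnifies a discrepancy at
  \<open>x\<close> by \<open>d ^ n\<close>. This yields uniqueness of the marking conjugacy.\<close>

lemma commutes_with_expansion_imp_id:
  fixes \<tau> :: "real \<Rightarrow> real"
  assumes "d \<ge> 2" "mono \<tau>" "\<tau> 0 = 0" "\<And>x. \<tau> (x + 1) = \<tau> x + 1" and d: "\<And>x. \<tau> (real d * x) = real d * \<tau> x"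
  shows "\<tau> x = x"
proof -
  have int: "\<tau> (of_int k) = of_int k" for k
    using add_of_int_equivariant[of \<tau> 1 0 k, OF assms(4)] assms(3) by simp
  have pow: "\<tau> (real d ^ n * x) = real d ^ n * \<tau> x" for n
  proof (induction n)
    case (Suc n)
    then show ?case using d[of "real d ^ n * x"] by (simp add: mult.assoc)
  qed simp
  have bound: "real n * \<bar>\<tau> x - x\<bar> \<le> 1" for n
  proof -
    let ?y = "real d ^ n * x"
    have "\<tau> (of_int \<lfloor>?y\<rfloor>) \<le> \<tau> ?y" "\<tau> ?y \<le> \<tau> (of_int (\<lfloor>?y\<rfloor> + 1))"
      by (intro monoD[OF assms(2)]; linarith)+
    then have "of_int \<lfloor>?y\<rfloor> \<le> \<tau> ?y" "\<tau> ?y \<le> of_int \<lfloor>?y\<rfloor> + 1" unfolding int by simp_all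
    then have "\<bar>\<tau> ?y - ?y\<bar> \<le> 1" by linarith
    then have "real d ^ n * \<bar>\<tau> x - x\<bar> \<le> 1"
      unfolding pow right_diff_distrib[symmetric] abs_mult by simp
    moreover have "real n \<le> real d ^ n"
    proof -
      have "n \<le> 2 ^ n" by (rule less_imp_le[OF less_exp])
      also have "2 ^ n \<le> d ^ n" using assms(1) by (rule power_mono) simp
      finally show ?thesis by (metis of_nat_le_iff of_nat_power)
    qed
    then have "real n * \<bar>\<tau> x - x\<bar> \<le> real d ^ n * \<bar>\<tau> x - x\<bar>" by (rule mult_right_mono) simp
    ultimately show ?thesis by linarith
  qed
  show ?thesis
  proof (rule ccontr)
    assume "\<tau> x \<noteq> x"
    then have "\<bar>\<tau> x - x\<bar> > 0" by simp
    from reals_Archimedean3[OF this] obtain n where "1 < real n * \<bar>\<tau> x - x\<bar>" by blast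
    with bound[of n] show False by simp
  qed
qed

lemma linearizes_bij:
  assumes L: "linearizes d k \<Phi> F" and k: "k \<ge> 1"
  shows "strict_mono \<Phi>" "\<Phi> (inv \<Phi> x) = x" "inv \<Phi> (\<Phi> x) = x" "strict_mono (inv \<Phi>)"
    "cont_diff k (inv \<Phi>)" "inv \<Phi> (x + 1) = inv \<Phi> x + 1"
proof -
  obtain m where m: "k = Suc m" using k by (cases k) auto
  have \<Phi>: "\<Phi> 0 = 0" "\<And>x. \<Phi> (x + 1) = \<Phi> x + 1" "\<And>x. deriv \<Phi> x > 0" "cont_diff (Suc m) \<Phi>"
    using L unfolding linearizes_def m by blast+
  have der: "\<And>x. (\<Phi> has_real_derivative deriv \<Phi> x) (at x)"
    using \<Phi>(4) unfolding cont_diff_Suc_deriv by blast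
  show mono: "strict_mono \<Phi>"
  proof (rule strict_monoI)
    fix x y :: real
    assume "x < y"
    then show "\<Phi> x < \<Phi> y" using der \<Phi>(3) DERIV_pos_imp_increasing by blast
  qed
  have "\<Phi> (of_int j) = of_int j * 1" for j
    using add_of_int_equivariant[of \<Phi> 1 0 j, OF \<Phi>(2)] \<Phi>(1) by simp
  then have "\<exists>y. \<Phi> y = x" for x
    by (intro surj_of_integers[OF cont_diff_continuous[OF \<Phi>(4)] order_refl])
  then show inv1: "\<Phi> (inv \<Phi> x) = x" for x by (metis f_inv_into_f rangeI)
  show inv2: "inv \<Phi> (\<Phi> x) = x" for x by (rule inv_f_f[OF strict_mono_imp_inj_on[OF mono]])
  show "strict_mono (inv \<Phi>)"
    by (rule strict_monoI) (metis inv1 mono strict_mono_less)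
  show "cont_diff k (inv \<Phi>)"
    unfolding m by (rule cont_diff_inverse_bij[OF \<Phi>(4,3) inv1])
  show "inv \<Phi> (x + 1) = inv \<Phi> x + 1" by (metis inv1 inv2 \<Phi>(2))
qed

text \<open>Independent of the representative when \<Theta> commutes with the translation by 1, the
  case in which it is applied.\<close>

definition project :: "(real \<Rightarrow> real) \<Rightarrow> circle \<Rightarrow> circle" where
  "project \<Theta> p = to_circle (\<Theta> (rep_circle p))"

lemma project_to_circle:
  assumes "\<And>x. \<Theta> (x + 1) = \<Theta> x + 1"
  shows "project \<Theta> (to_circle x) = to_circle (\<Theta> x)"
proof -
  obtain k where k: "x = rep_circle (to_circle x) + of_int k" using rep_to_circle by blast
  have "\<Theta> x = \<Theta> (rep_circle (to_circle x)) + of_int k"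
    using add_of_int_equivariant[of \<Theta> 1, OF assms] k by (metis mult.right_neutral)
  then show ?thesis unfolding project_def to_circle_eq_iff by simp
qed

text \<open>The increment over a period is an integer, positive by monotonicity. If it were at least
  2, \<Psi> would take the value 1 strictly between \<open>0\<close> and \<open>1\<close>, producing
  a second point with the same image as \<open>0\<close>.\<close>

lemma is_lift_inj_on_circle:
  assumes lift: "is_lift \<Psi> \<phi>" and "inj \<phi>" "strict_mono \<Psi>" and 0: "\<Psi> 0 = 0"
  shows "\<Psi> (x + 1) = \<Psi> x + 1"
proof -
  have cont: "continuous_on UNIV \<Psi>" and \<Psi>: "to_circle (\<Psi> x) = \<phi> (to_circle x)" for x
    using lift unfolding is_lift_def by auto
  have "to_circle (x + 1) = to_circle x" for x by (simp add: to_circle_eq_iff)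
  then have "is_lift (\<lambda>x. \<Psi> (x + 1)) \<phi>"
    unfolding is_lift_def \<Psi> by (auto intro!: continuous_on_compose2[OF cont] continuous_intros)
  from is_lift_unique_plus_int[OF this lift] obtain k where k: "\<And>x. \<Psi> (x + 1) = \<Psi> x + of_int k"
    by blast
  have 1: "\<Psi> 1 = of_int k" using k[of 0] 0 by simp
  have "\<Psi> 0 < \<Psi> 1" by (rule strict_monoD[OF assms(3)]) simp
  then have "k \<ge> 1" unfolding 0 1 by linarith
  moreover have "\<not> k \<ge> 2"
  proof
    assume k2: "k \<ge> 2"
    have "\<exists>x\<ge>0. x \<le> 1 \<and> \<Psi> x = 1"
      by (rule IVT') (use k2 0 1 continuous_on_subset[OF cont] in auto)
    then obtain x where x: "0 \<le> x" "x \<le> 1" "\<Psi> x = 1" by blast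
    have "\<phi> (to_circle x) = \<phi> (to_circle 0)"
      unfolding \<Psi>[symmetric] x(3) 0 by (simp add: to_circle_eq_iff)
    then have "x - 0 \<in> \<int>" using injD[OF assms(2)] unfolding to_circle_eq_iff[symmetric] by blast
    then obtain i where i: "x = of_int i" by (auto elim: Ints_cases)
    then have "i = 0 \<or> i = 1" using x by auto
    then show False using i x(3) 0 1 k2 by auto
  qed
  ultimately have "k = 1" by simp
  then show ?thesis using k by simp
qed

text \<open>Both maps are conjugate to multiplication by \<open>d\<close>, so
  \<open>inv \<Psi> \<circ> \<Phi>\<close> lifts a smooth conjugacy between them. Any other marking
  conjugacy, read in the linearizing coordinates, commutes with multiplication by \<open>d\<close>
  and is therefore the identity there.\<close>

lemma smooth_marking_conjugacy:
  assumes F: "is_lift F f" "F 0 = 0" and E: "is_lift E g" "E 0 = 0" and d: "d \<ge> 2" and k: "k \<ge> 1"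
    and L\<^sub>1: "linearizes d k \<Phi> F" and L\<^sub>2: "linearizes d k \<Psi> E"
  shows "\<exists>\<phi>. marking_conjugacy f g \<phi> \<and> C_k_diffeomorphism k \<phi> \<and>
    (\<forall>\<phi>'. marking_conjugacy f g \<phi>' \<longrightarrow> \<phi>' = \<phi>)"
proof -
  note \<Phi> = linearizes_bij[OF L\<^sub>1 k] and \<Psi> = linearizes_bij[OF L\<^sub>2 k]
  have \<Phi>': "\<Phi> 0 = 0" "\<And>x. \<Phi> (x + 1) = \<Phi> x + 1" "\<And>x. \<Phi> (F x) = real d * \<Phi> x" "cont_diff k \<Phi>"
    using L\<^sub>1 unfolding linearizes_def by auto
  have \<Psi>': "\<Psi> 0 = 0" "\<And>x. \<Psi> (x + 1) = \<Psi> x + 1" "\<And>x. \<Psi> (E x) = real d * \<Psi> x" "cont_diff k \<Psi>"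
    using L\<^sub>2 unfolding linearizes_def by auto
  define \<Theta> where "\<Theta> x = inv \<Psi> (\<Phi> x)" for x
  define \<Xi> where "\<Xi> x = inv \<Phi> (\<Psi> x)" for x
  have shift: "\<Theta> (x + 1) = \<Theta> x + 1" "\<Xi> (x + 1) = \<Xi> x + 1" for x
    by (simp_all add: \<Theta>_def \<Xi>_def \<Phi>'(2) \<Psi>'(2) \<Phi>(6) \<Psi>(6))
  have inverse: "\<Theta> (\<Xi> x) = x" "\<Xi> (\<Theta> x) = x" for x
    by (simp_all add: \<Theta>_def \<Xi>_def \<Phi>(2,3) \<Psi>(2,3))
  have C: "cont_diff k \<Theta>" "cont_diff k \<Xi>"
    unfolding \<Theta>_def[abs_def] \<Xi>_def[abs_def]
    by (rule cont_diff_compose[OF \<Psi>(5) \<Phi>'(4)], rule cont_diff_compose[OF \<Phi>(5) \<Psi>'(4)])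
  have "\<Theta> (F x) = E (\<Theta> x)" for x
  proof -
    have "\<Psi> (\<Theta> (F x)) = \<Psi> (E (\<Theta> x))" by (simp add: \<Theta>_def \<Psi>(2) \<Phi>'(3) \<Psi>'(3))
    then show ?thesis using strict_mono_eq[OF \<Psi>(1)] by blast
  qed
  note conj = this
  define \<phi> where "\<phi> = project \<Theta>"
  have \<phi>: "\<phi> (to_circle x) = to_circle (\<Theta> x)" for x
    unfolding \<phi>_def by (rule project_to_circle[of \<Theta>, OF shift(1)])
  have \<phi>': "project \<Xi> (to_circle x) = to_circle (\<Xi> x)" for x
    by (rule project_to_circle[of \<Xi>, OF shift(2)])
  have inv1: "\<phi> (project \<Xi> p) = p" and inv2: "project \<Xi> (\<phi> p) = p" for p
    using \<phi> \<phi>' inverse to_circle_rep[of p] by metis+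
  have bij: "bij \<phi>" using inv1 inv2 by (metis bijI')
  have inv: "inv \<phi> = project \<Xi>" by (rule inv_unique_comp) (auto simp: inv1 inv2)
  have lift: "is_lift \<Theta> \<phi>" "is_lift \<Xi> (inv \<phi>)"
    unfolding is_lift_def inv using \<phi> \<phi>' cont_diff_continuous C by auto
  have \<Theta>_mono: "strict_mono \<Theta>"
    using \<Phi>(1) \<Psi>(4) by (simp add: \<Theta>_def strict_mono_def)
  have \<phi>0: "\<phi> 0 = 0"
    using \<phi>[of 0] \<Psi>(3)[of 0] by (simp add: zero_circle_def \<Theta>_def \<Phi>'(1) \<Psi>'(1))
  have "homeomorphism UNIV UNIV \<phi> (inv \<phi>)"
    unfolding homeomorphism_def
    using bij is_lift_continuous[OF lift(1)] is_lift_continuous[OF lift(2)]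
    by (auto simp: bij_is_inj bij_is_surj surj_f_inv_f bij_imp_bij_inv)
  moreover have "g p = (\<phi> \<circ> f \<circ> inv \<phi>) p" for p
  proof -
    have "to_circle (\<Theta> (F (\<Xi> (rep_circle p)))) = g p"
      unfolding conj inverse using E(1) to_circle_rep[of p] by (simp add: is_lift_def)
    moreover have "to_circle (\<Theta> (F (\<Xi> x))) = \<phi> (f (inv \<phi> (to_circle x)))" for x
      using F(1) lift(2) \<phi> unfolding is_lift_def by metis
    ultimately show ?thesis using to_circle_rep[of p] by simp
  qed
  ultimately have marking: "marking_conjugacy f g \<phi>"
    unfolding marking_conjugacy_def orientation_preserving_def using lift(1) \<Theta>_mono \<phi>0 by blast
  have diffeo: "C_k_diffeomorphism k \<phi>"
    unfolding C_k_diffeomorphism_def circle_C_k_def C_k_iff_cont_diff using bij lift C by blast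
  have "\<phi>' = \<phi>" if m: "marking_conjugacy f g \<phi>'" for \<phi>'
  proof -
    have hom: "homeomorphism UNIV UNIV \<phi>' (inv \<phi>')" and \<phi>'0: "\<phi>' 0 = 0" and g: "g = \<phi>' \<circ> f \<circ> inv \<phi>'"
      using m unfolding marking_conjugacy_def by auto
    have inv': "inv \<phi>' (\<phi>' p) = p" for p using hom unfolding homeomorphism_def by blast
    then have inj: "inj \<phi>'" by (metis injI)
    obtain \<Omega>\<^sub>0 where \<Omega>0: "is_lift \<Omega>\<^sub>0 \<phi>'" "strict_mono \<Omega>\<^sub>0"
      using m unfolding marking_conjugacy_def orientation_preserving_def by blast
    define \<Omega> where "\<Omega> x = \<Omega>\<^sub>0 x - \<Omega>\<^sub>0 0" for x
    have \<Omega>_lift: "is_lift \<Omega> \<phi>'"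
      unfolding \<Omega>_def[abs_def] by (intro is_lift_minus_int \<Omega>0 is_lift_0_Ints[OF \<Omega>0(1) \<phi>'0])
    have \<Omega>_mono: "strict_mono \<Omega>" using \<Omega>0(2) by (simp add: \<Omega>_def strict_mono_def)
    have \<Omega>_0: "\<Omega> 0 = 0" by (simp add: \<Omega>_def)
    note \<Omega>_shift = is_lift_inj_on_circle[OF \<Omega>_lift inj \<Omega>_mono \<Omega>_0]
    \<comment> \<open>Both sides lift \<open>\<phi>' \<circ> f\<close> and vanish at
      \<open>0\<close>, so the conjugacy equation holds for the lifts exactly, not just up to an
      integer.\<close>
    have "(\<lambda>x. \<Omega> (F x)) = (\<lambda>x. E (\<Omega> x))"
    proof (rule is_lift_unique)
      show "is_lift (\<lambda>x. \<Omega> (F x)) (\<lambda>p. \<phi>' (f p))"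
        using \<Omega>_lift F(1) unfolding is_lift_def by (auto intro: continuous_on_compose2)
      show "is_lift (\<lambda>x. E (\<Omega> x)) (\<lambda>p. \<phi>' (f p))"
        using \<Omega>_lift E(1) unfolding is_lift_def by (auto simp: g inv' intro: continuous_on_compose2)
    qed (simp add: F E \<Omega>_0)
    then have conj': "\<Omega> (F x) = E (\<Omega> x)" for x by meson
    define \<tau> where "\<tau> x = \<Psi> (\<Omega> (inv \<Phi> x))" for x
    have "\<tau> x = x" for x
    proof (rule commutes_with_expansion_imp_id[OF d])
      show "mono \<tau>"
        using \<Psi>(1) \<Omega>_mono \<Phi>(4) by (intro strict_mono_mono) (simp add: \<tau>_def strict_mono_def)
      show "\<tau> 0 = 0" using \<Phi>(3)[of 0] by (simp add: \<tau>_def \<Phi>'(1) \<Psi>'(1) \<Omega>_0)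
      show "\<tau> (x + 1) = \<tau> x + 1" for x by (simp add: \<tau>_def \<Phi>(6) \<Omega>_shift \<Psi>'(2))
      show "\<tau> (real d * x) = real d * \<tau> x" for x
      proof -
        have "inv \<Phi> (real d * x) = F (inv \<Phi> x)"
          using \<Phi>(3)[of "F (inv \<Phi> x)"] by (simp add: \<Phi>'(3) \<Phi>(2))
        then show ?thesis by (simp add: \<tau>_def conj' \<Psi>'(3))
      qed
    qed
    from this[of "\<Phi> x" for x] have "\<Psi> (\<Omega> x) = \<Phi> x" for x by (simp add: \<tau>_def \<Phi>(3))
    then have "\<Omega> x = \<Theta> x" for x unfolding \<Theta>_def using \<Psi>(3) by metis
    then have "\<phi>' (to_circle x) = \<phi> (to_circle x)" for x
      using \<Omega>_lift lift(1) unfolding is_lift_def by metis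
    then have "\<phi>' p = \<phi> p" for p using to_circle_rep[of p] by metis
    then show ?thesis by blast
  qed
  with marking diffeo show ?thesis by blast
qed

theorem mainTheorem2:
  fixes d r :: nat
  assumes "d \<ge> 2" and "r \<ge> 2"
  shows "\<exists>\<beta>\<^sub>0 > 0. \<exists>\<gamma>\<^sub>0 > 0. \<forall>\<beta> \<gamma> :: real.
    0 < \<beta> \<and> \<beta> < \<gamma> \<and> \<beta> \<le> \<beta>\<^sub>0 \<and> \<gamma> \<ge> \<gamma>\<^sub>0 \<longrightarrow>
    (\<forall>g \<in> lebesgue_expanding_maps d (r + 1).
      C_k_norm 2 (circle_diff g (linear_map d)) < (real d - 1) / 2 \<and>
      sparse_spectrum \<beta> \<gamma> (length_spectrum g) \<longrightarrow>
      (\<exists>\<epsilon> > 0. \<forall>f \<in> expanding_maps d r.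
        C_k1_norm r (circle_diff f g) < \<epsilon> \<and> length_spectrum f = length_spectrum g \<longrightarrow>
        C_k_conjugate r f g \<and>
        (\<exists>!\<phi>. marking_conjugacy f g \<phi>) \<and>
        (\<forall>\<phi>. marking_conjugacy f g \<phi> \<longrightarrow> C_k_diffeomorphism r \<phi>)))"
proof -
  have main: "C_k_conjugate r f g \<and> (\<exists>!\<phi>. marking_conjugacy f g \<phi>) \<and>
      (\<forall>\<phi>. marking_conjugacy f g \<phi> \<longrightarrow> C_k_diffeomorphism r \<phi>)"
    if \<beta>: "0 < \<beta>" "\<beta> \<le> 1 / 8" and \<gamma>: "\<gamma> \<ge> 1" and g: "g \<in> lebesgue_expanding_maps d (r + 1)"
      and sparse: "sparse_spectrum \<beta> \<gamma> (length_spectrum g)"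
      and f: "f \<in> expanding_maps d r" and eq: "length_spectrum f = length_spectrum g"
    for \<beta> \<gamma> f g
  proof -
    have g': "g \<in> expanding_maps d (r + 1)" using g unfolding lebesgue_expanding_maps_def by blast
    have r: "r + 1 \<ge> 2" "r \<ge> 1" using assms(2) by auto
    obtain E \<Psi> where E: "is_lift E g" "E 0 = 0" "linearizes d (r + 1) \<Psi> E"
      using sparse_imp_linearizes[OF g' assms(1) r(1) sparse \<beta> \<gamma>] by blast
    have E': "linearizes d r \<Psi> E"
      using E(3) cont_diff_mono[of "r + 1" \<Psi> r] unfolding linearizes_def by simp
    \<comment> \<open>Equality of the spectra makes that of \<open>f\<close> sparse too, so
      \<open>f\<close> gets a linearization of its own.\<close>
    obtain F \<Phi> where F: "is_lift F f" "F 0 = 0" "linearizes d r \<Phi> F"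
      using sparse_imp_linearizes[OF f assms sparse[folded eq] \<beta> \<gamma>] by blast
    obtain \<phi> where \<phi>: "marking_conjugacy f g \<phi>" "C_k_diffeomorphism r \<phi>"
        "\<And>\<phi>'. marking_conjugacy f g \<phi>' \<Longrightarrow> \<phi>' = \<phi>"
      using smooth_marking_conjugacy[OF F(1,2) E(1,2) assms(1) r(2) F(3) E'] by blast
    moreover have "C_k_conjugate r f g"
      using \<phi>(1,2) unfolding C_k_conjugate_def marking_conjugacy_def by blast
    ultimately show ?thesis by blast
  qed
  \<comment> \<open>The witnesses \<open>1 / 8\<close> and \<open>1\<close> for
    \<open>\<beta>\<^sub>0\<close> and \<open>\<gamma>\<^sub>0\<close> are the bounds of
    \<open>sparse_imp_linearizes\<close>, the same for all \<open>d\<close> and \<open>r\<close>;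
    the witness for \<epsilon> is \<open>1\<close>.\<close>
  show ?thesis
    by (rule exI[of _ "1 / 8"], rule conjI, simp, rule exI[of _ 1], rule conjI, simp,
        intro allI impI ballI, rule exI[of _ 1], rule conjI, simp, intro ballI impI,
        elim conjE, rule main, assumption+)
qed

end
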